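(* Let $R$ be a ring and $M$ a non-zero Baer right $R$-module. Then $M=\bigoplus_{i=1}^n M_i$ for some $n$ and submodules $M_i$ such that each $M_i$ is a prime $R$-module, the $M_i$ are mutually orthogonal, and $\mathrm{Hom}_R(M_i,M_j)=0$ for all $i\neq j$, if and only if $\tau\mathrm{dim}(M)<\infty$ and every direct summand of $M$ is retractable.
   Context: Rings have a unit element and modules are right unitary modules. $M$ is Baer if for every non-empty subset $X\subseteq \mathrm{End}_R(M)$ the submodule $\bigcap_{f\in X}\ker f$ is a direct summand of $M$. An $R$-module is prime if it is cogenerated by each of its nonzero submodules (i.e. $P$ embeds in a direct product of copies of $N$ for every $0\neq N\leq P$). Two $R$-modules are orthogonal if they do not contain nonzero isomorphic submodules. An $R$-module $N$ is retractable if $\mathrm{Hom}_R(N,K)\neq 0$ for every nonzero submodule $K\leq N$. The triangulating dimension is $\tau\mathrm{dim}(M)=\sup\{k\in\mathbb{N} : M=\bigoplus_{i=1}^k M_i \text{ with } M_i\neq 0 \text{ and } \mathrm{Hom}_R(M_i,M_j)=0 \text{ for all } i<j\}$. *)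

theory Defs
  imports "HOL-Algebra.Module" "HOL-Algebra.AbelCoset" "HOL-Library.Extended_Nat"
begin

text \<open>
  Modules are unital right modules over a not necessarily commutative ring. They use the record
  type of \<^theory>\<open>HOL-Algebra.Module\<close> (whose locale \<open>module\<close> demands a commutative ring), so the
  right action \<open>x \<cdot> a\<close> is written \<open>a \<odot> x\<close>. The axiom \<open>smult_assoc\<close> is what makes it a right
  action: \<open>x \<cdot> (a b) = (x \<cdot> a) \<cdot> b\<close>.
\<close>

locale right_module = R?: ring R + M?: abelian_group M
  for R (structure) and M :: "('a, 'b, 'm) module_scheme" (structure) +
  assumes smult_closed:
      "\<lbrakk>a \<in> carrier R; x \<in> carrier M\<rbrakk> \<Longrightarrow> a \<odot>\<^bsub>M\<^esub> x \<in> carrier M"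
    and smult_l_distr:
      "\<lbrakk>a \<in> carrier R; b \<in> carrier R; x \<in> carrier M\<rbrakk>
        \<Longrightarrow> (a \<oplus>\<^bsub>R\<^esub> b) \<odot>\<^bsub>M\<^esub> x = a \<odot>\<^bsub>M\<^esub> x \<oplus>\<^bsub>M\<^esub> b \<odot>\<^bsub>M\<^esub> x"
    and smult_r_distr:
      "\<lbrakk>a \<in> carrier R; x \<in> carrier M; y \<in> carrier M\<rbrakk>
        \<Longrightarrow> a \<odot>\<^bsub>M\<^esub> (x \<oplus>\<^bsub>M\<^esub> y) = a \<odot>\<^bsub>M\<^esub> x \<oplus>\<^bsub>M\<^esub> a \<odot>\<^bsub>M\<^esub> y"
    and smult_assoc:
      "\<lbrakk>a \<in> carrier R; b \<in> carrier R; x \<in> carrier M\<rbrakk>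
        \<Longrightarrow> (a \<otimes>\<^bsub>R\<^esub> b) \<odot>\<^bsub>M\<^esub> x = b \<odot>\<^bsub>M\<^esub> (a \<odot>\<^bsub>M\<^esub> x)"
    and smult_one:
      "x \<in> carrier M \<Longrightarrow> \<one>\<^bsub>R\<^esub> \<odot>\<^bsub>M\<^esub> x = x"

text \<open>
  As in the library, a submodule is a subset \<open>N\<close> with \<open>submodule N R M\<close>, and
  \<open>M\<lparr>carrier := N\<rparr>\<close> is that submodule as a module in its own right.
\<close>

abbreviation sub_module :: "('a, 'b, 'm) module_scheme \<Rightarrow> 'b set \<Rightarrow> ('a, 'b, 'm) module_scheme"
    (infixl \<open>\<restriction>\<^sub>M\<close> 90)
  where "M \<restriction>\<^sub>M N \<equiv> M\<lparr>carrier := N\<rparr>"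

text \<open>Homomorphisms are extensional, so that the zero map is the only zero element of the set.\<close>

definition Hom ::
    "('a, 'r) ring_scheme \<Rightarrow> ('a, 'b, 'm) module_scheme \<Rightarrow> ('a, 'c, 'n) module_scheme \<Rightarrow> ('b \<Rightarrow> 'c) set"
  where "Hom R M N = {f \<in> carrier M \<rightarrow>\<^sub>E carrier N.
      (\<forall>x\<in>carrier M. \<forall>y\<in>carrier M. f (x \<oplus>\<^bsub>M\<^esub> y) = f x \<oplus>\<^bsub>N\<^esub> f y) \<and>
      (\<forall>a\<in>carrier R. \<forall>x\<in>carrier M. f (a \<odot>\<^bsub>M\<^esub> x) = a \<odot>\<^bsub>N\<^esub> f x)}"

definition Hom_zero ::
    "('a, 'r) ring_scheme \<Rightarrow> ('a, 'b, 'm) module_scheme \<Rightarrow> ('a, 'c, 'n) module_scheme \<Rightarrow> bool"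
  where "Hom_zero R M N \<longleftrightarrow> Hom R M N = {\<lambda>x\<in>carrier M. \<zero>\<^bsub>N\<^esub>}"

definition isomorphic_modules ::
    "('a, 'r) ring_scheme \<Rightarrow> ('a, 'b, 'm) module_scheme \<Rightarrow> ('a, 'c, 'n) module_scheme \<Rightarrow> bool"
  where "isomorphic_modules R M N \<longleftrightarrow> (\<exists>f\<in>Hom R M N. bij_betw f (carrier M) (carrier N))"

definition direct_summand ::
    "('a, 'r) ring_scheme \<Rightarrow> ('a, 'b, 'm) module_scheme \<Rightarrow> 'b set \<Rightarrow> bool"
  where "direct_summand R M N \<longleftrightarrow> submodule N R M \<and>
      (\<exists>K. submodule K R M \<and> N <+>\<^bsub>M\<^esub> K = carrier M \<and> N \<inter> K = {\<zero>\<^bsub>M\<^esub>})"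

definition is_direct_sum ::
    "('a, 'r) ring_scheme \<Rightarrow> ('a, 'b, 'm) module_scheme \<Rightarrow> 'i set \<Rightarrow> ('i \<Rightarrow> 'b set) \<Rightarrow> bool"
    \<comment> \<open>internal direct sum; only meant for finite index sets\<close>
  where "is_direct_sum R M I N \<longleftrightarrow> (\<forall>i\<in>I. submodule (N i) R M) \<and>
      (\<forall>x\<in>carrier M. \<exists>!f. f \<in> (\<Pi>\<^sub>E i\<in>I. N i) \<and> x = (\<Oplus>\<^bsub>M\<^esub>i\<in>I. f i))"

definition baer :: "('a, 'r) ring_scheme \<Rightarrow> ('a, 'b, 'm) module_scheme \<Rightarrow> bool"
  where "baer R M \<longleftrightarrow>
      (\<forall>X. X \<subseteq> Hom R M M \<and> X \<noteq> {} \<longrightarrow> direct_summand R M (\<Inter>f\<in>X. a_kernel M M f))"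

definition direct_product ::
    "'i set \<Rightarrow> ('i \<Rightarrow> ('a, 'b, 'm) module_scheme) \<Rightarrow> ('a, 'i \<Rightarrow> 'b) module"
    \<comment> \<open>the ring multiplication and unit in the record are irrelevant for modules\<close>
  where "direct_product I N =
      \<lparr>carrier = (\<Pi>\<^sub>E i\<in>I. carrier (N i)),
       monoid.mult = (\<lambda>x y. \<lambda>i\<in>I. x i \<otimes>\<^bsub>N i\<^esub> y i),
       one = (\<lambda>i\<in>I. \<one>\<^bsub>N i\<^esub>),
       zero = (\<lambda>i\<in>I. \<zero>\<^bsub>N i\<^esub>),
       add = (\<lambda>x y. \<lambda>i\<in>I. x i \<oplus>\<^bsub>N i\<^esub> y i),
       smult = (\<lambda>a x. \<lambda>i\<in>I. a \<odot>\<^bsub>N i\<^esub> x i)\<rparr>"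

text \<open>
  A definition cannot quantify over the type of the index set. Index sets of elements of the
  embedded module suffice, see \<open>cogenerated_byI\<close> below.
\<close>

definition cogenerated_by ::
    "('a, 'r) ring_scheme \<Rightarrow> ('a, 'b, 'm) module_scheme \<Rightarrow> ('a, 'c, 'n) module_scheme \<Rightarrow> bool"
  where "cogenerated_by R P N \<longleftrightarrow>
      (\<exists>I :: 'b set. \<exists>f\<in>Hom R P (direct_product I (\<lambda>_. N)). inj_on f (carrier P))"

definition prime_module :: "('a, 'r) ring_scheme \<Rightarrow> ('a, 'b, 'm) module_scheme \<Rightarrow> bool"
  where "prime_module R P \<longleftrightarrow>
      (\<forall>N. submodule N R P \<and> N \<noteq> {\<zero>\<^bsub>P\<^esub>} \<longrightarrow> cogenerated_by R P (P \<restriction>\<^sub>M N))"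

definition orthogonal_modules ::
    "('a, 'r) ring_scheme \<Rightarrow> ('a, 'b, 'm) module_scheme \<Rightarrow> ('a, 'c, 'n) module_scheme \<Rightarrow> bool"
  where "orthogonal_modules R M N \<longleftrightarrow>
      \<not> (\<exists>A B. submodule A R M \<and> A \<noteq> {\<zero>\<^bsub>M\<^esub>} \<and> submodule B R N \<and> B \<noteq> {\<zero>\<^bsub>N\<^esub>} \<and>
            isomorphic_modules R (M \<restriction>\<^sub>M A) (N \<restriction>\<^sub>M B))"

definition retractable :: "('a, 'r) ring_scheme \<Rightarrow> ('a, 'b, 'm) module_scheme \<Rightarrow> bool"
  where "retractable R N \<longleftrightarrow>
      (\<forall>K. submodule K R N \<and> K \<noteq> {\<zero>\<^bsub>N\<^esub>} \<longrightarrow> \<not> Hom_zero R N (N \<restriction>\<^sub>M K))"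

definition tau_dim :: "('a, 'r) ring_scheme \<Rightarrow> ('a, 'b, 'm) module_scheme \<Rightarrow> enat"
  where "tau_dim R M = Sup {enat k | k. \<exists>N :: nat \<Rightarrow> 'b set.
      is_direct_sum R M {1..k} N \<and> (\<forall>i\<in>{1..k}. N i \<noteq> {\<zero>\<^bsub>M\<^esub>}) \<and>
      (\<forall>i\<in>{1..k}. \<forall>j\<in>{1..k}. i < j \<longrightarrow> Hom_zero R (M \<restriction>\<^sub>M N i) (M \<restriction>\<^sub>M N j))}"

lemma (in right_module) submodule_is_right_module:
  assumes "submodule N R M"
  shows "right_module R (M \<restriction>\<^sub>M N)"
proof -
  interpret N: submodule N R M by fact
  have sub: "N \<subseteq> carrier M" using N.subset by simp
  have "group (add_monoid M\<lparr>carrier := N\<rparr>)"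
    using N.subgroup_is_group add.is_group by simp
  moreover have "comm_monoid (add_monoid M\<lparr>carrier := N\<rparr>)"
    using comm_monoid.submonoid_is_comm_monoid[OF a_comm_monoid N.subgroup_is_submonoid] by simp
  ultimately have "abelian_group (M \<restriction>\<^sub>M N)"
    by (simp add: abelian_group_def abelian_group_axioms_def abelian_monoid_def comm_group_def)
  then show ?thesis
    using sub
    by (intro right_module.intro right_module_axioms.intro)
       (auto simp: N.smult_closed smult_l_distr smult_r_distr smult_assoc smult_one
                   subset_iff R.ring_axioms)
qed

lemma cogenerated_byI:
  fixes I :: "'i set" and P :: "('a, 'b, 'm) module_scheme" and N :: "('a, 'c, 'n) module_scheme"
  assumes "right_module R P" "right_module R N"
    and f: "f \<in> Hom R P (direct_product I (\<lambda>_. N))" and inj: "inj_on f (carrier P)"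
  shows "cogenerated_by R P N"
proof -
  interpret P: right_module R P by fact
  interpret N: right_module R N by fact
  have fc: "f x i \<in> carrier N" if "x \<in> carrier P" "i \<in> I" for x i
    using f that by (auto simp: Hom_def direct_product_def PiE_iff)
  have fext: "f x \<in> extensional I" if "x \<in> carrier P" for x
    using f that by (auto simp: Hom_def direct_product_def PiE_iff)
  have fadd: "f (x \<oplus>\<^bsub>P\<^esub> y) i = f x i \<oplus>\<^bsub>N\<^esub> f y i"
    if "x \<in> carrier P" "y \<in> carrier P" "i \<in> I" for x y i
    using f that by (auto simp: Hom_def direct_product_def)
  have fsm: "f (a \<odot>\<^bsub>P\<^esub> x) i = a \<odot>\<^bsub>N\<^esub> f x i"
    if "a \<in> carrier R" "x \<in> carrier P" "i \<in> I" for a x i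
    using f that by (auto simp: Hom_def direct_product_def)
  have f0: "f \<zero>\<^bsub>P\<^esub> i = \<zero>\<^bsub>N\<^esub>" if "i \<in> I" for i
    using fadd[of "\<zero>\<^bsub>P\<^esub>" "\<zero>\<^bsub>P\<^esub>" i] fc[of "\<zero>\<^bsub>P\<^esub>" i] that
    by (metis N.M.add.r_cancel_one' P.M.l_zero P.M.zero_closed)
  define J where "J = carrier P - {\<zero>\<^bsub>P\<^esub>}"
  have "\<exists>i\<in>I. f z i \<noteq> \<zero>\<^bsub>N\<^esub>" if "z \<in> J" for z
  proof (rule ccontr)
    assume "\<not> (\<exists>i\<in>I. f z i \<noteq> \<zero>\<^bsub>N\<^esub>)"
    then have "f z = f \<zero>\<^bsub>P\<^esub>"
      using that f0 by (intro extensionalityI[of _ I]) (auto simp: J_def fext)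
    then show False using that inj by (auto simp: J_def inj_on_def)
  qed
  then obtain i where i: "\<And>z. z \<in> J \<Longrightarrow> i z \<in> I \<and> f z (i z) \<noteq> \<zero>\<^bsub>N\<^esub>" by metis
  define g where "g = (\<lambda>x\<in>carrier P. \<lambda>z\<in>J. f x (i z))"
  have "g \<in> Hom R P (direct_product J (\<lambda>_. N))"
    unfolding Hom_def direct_product_def g_def
    by (auto simp: i fc fadd fsm P.smult_closed fun_eq_iff)
  moreover have "inj_on g (carrier P)"
  proof (rule inj_onI, rule ccontr)
    fix x y assume xy: "x \<in> carrier P" "y \<in> carrier P" "g x = g y" "x \<noteq> y"
    define z where "z = x \<ominus>\<^bsub>P\<^esub> y"
    have zc: "z \<in> carrier P" using xy by (simp add: z_def)
    have "z \<oplus>\<^bsub>P\<^esub> y = x \<oplus>\<^bsub>P\<^esub> (\<ominus>\<^bsub>P\<^esub> y \<oplus>\<^bsub>P\<^esub> y)"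
      unfolding z_def P.M.minus_eq using xy by (intro P.M.a_assoc) auto
    then have xz: "x = z \<oplus>\<^bsub>P\<^esub> y" using xy by (simp add: P.M.l_neg)
    then have "z \<noteq> \<zero>\<^bsub>P\<^esub>" using xy(2,4) by auto
    then have z: "z \<in> J" "z \<in> carrier P" using zc by (auto simp: J_def)
    have "f x (i z) = f y (i z)"
      using fun_cong[OF xy(3), of z] xy z by (simp add: g_def)
    then have "f z (i z) \<oplus>\<^bsub>N\<^esub> f y (i z) = f y (i z)"
      using fadd[of z y "i z"] z(2) xy(2) i[OF z(1)] by (simp flip: xz)
    then show False using i[OF z(1)] fc[OF z(2)] fc[OF xy(2)]
      by simp
  qed
  ultimately show ?thesis unfolding cogenerated_by_def by blast
qed

end

theory Submission
  imports Defs
begin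

text \<open>
  A triangular decomposition of maximal length exists when \<open>\<tau>dim\<close> is finite.
  For a nonzero submodule \<open>Q\<close> of a component \<open>P\<close>, the common kernel \<open>K\<close> of all maps \<open>P \<rightarrow> Q\<close> is a
  summand by the Baer property and is fully invariant, so \<open>Hom(K, P/K) = 0\<close>; a proper nonzero \<open>K\<close>
  would lengthen the decomposition and \<open>K = P\<close> contradicts retractability, so \<open>K = 0\<close> and \<open>P\<close> is
  prime. A nonzero map \<open>f : M\<^sub>i \<rightarrow> M\<^sub>j\<close> has a summand as kernel, so its image embeds in \<open>M\<^sub>i\<close> and
  retractability of \<open>M\<^sub>j\<close> yields a nonzero map \<open>M\<^sub>j \<rightarrow> M\<^sub>i\<close>; hence vanishing of Hom is symmetric.

  Conversely, in a prime decomposition a component cannot have nonzero projections to two terms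
  \<open>L\<^sub>s\<close>, \<open>L\<^sub>l\<close> with \<open>s < l\<close> of a triangular decomposition, since primeness would give a nonzero map
  \<open>L\<^sub>s \<rightarrow> L\<^sub>l\<close>; this bounds \<open>\<tau>dim\<close>. A nonzero submodule on which as few projections as possible are
  nonzero lies in a single component by orthogonality, so every nonzero submodule meets some
  component \<open>M\<^sub>i\<close> and primeness of \<open>M\<^sub>i\<close> gives retractability.
\<close>

text \<open>
  Restricting everything to submodules of one fixed module \<open>M\<close> allows non-extensional maps: only the
  values of \<open>f\<close> on \<open>A\<close> matter.
\<close>

definition lin ::
    "('a, 'r) ring_scheme \<Rightarrow> ('a, 'b, 'm) module_scheme \<Rightarrow> 'b set \<Rightarrow> 'b set \<Rightarrow> ('b \<Rightarrow> 'b) \<Rightarrow> bool"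
  where "lin R M A B f \<longleftrightarrow> f \<in> A \<rightarrow> B \<and>
      (\<forall>x\<in>A. \<forall>y\<in>A. f (x \<oplus>\<^bsub>M\<^esub> y) = f x \<oplus>\<^bsub>M\<^esub> f y) \<and>
      (\<forall>a\<in>carrier R. \<forall>x\<in>A. f (a \<odot>\<^bsub>M\<^esub> x) = a \<odot>\<^bsub>M\<^esub> f x)"

definition lin_zero ::
    "('a, 'r) ring_scheme \<Rightarrow> ('a, 'b, 'm) module_scheme \<Rightarrow> 'b set \<Rightarrow> 'b set \<Rightarrow> bool"
  where "lin_zero R M A B \<longleftrightarrow> (\<forall>f. lin R M A B f \<longrightarrow> (\<forall>x\<in>A. f x = \<zero>\<^bsub>M\<^esub>))"

text \<open>
  Joint injectivity replaces the usual condition that the projections sum to the identity; for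
  finite \<open>I\<close> it is equivalent, and it avoids finite sums when decompositions are refined.
\<close>

definition proj_family ::
    "('a, 'r) ring_scheme \<Rightarrow> ('a, 'b, 'm) module_scheme \<Rightarrow> 'i set \<Rightarrow> ('i \<Rightarrow> 'b set) \<Rightarrow> ('i \<Rightarrow> 'b \<Rightarrow> 'b) \<Rightarrow> bool"
  where "proj_family R M I N p \<longleftrightarrow> (\<forall>i\<in>I. submodule (N i) R M \<and> lin R M (carrier M) (N i) (p i)) \<and>
      (\<forall>i\<in>I. \<forall>j\<in>I. \<forall>x\<in>N j. p i x = (if i = j then x else \<zero>\<^bsub>M\<^esub>)) \<and>
      (\<forall>x\<in>carrier M. (\<forall>i\<in>I. p i x = \<zero>\<^bsub>M\<^esub>) \<longrightarrow> x = \<zero>\<^bsub>M\<^esub>)"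

lemma linD:
  assumes "lin R M A B f"
  shows "x \<in> A \<Longrightarrow> f x \<in> B"
    and "x \<in> A \<Longrightarrow> y \<in> A \<Longrightarrow> f (x \<oplus>\<^bsub>M\<^esub> y) = f x \<oplus>\<^bsub>M\<^esub> f y"
    and "a \<in> carrier R \<Longrightarrow> x \<in> A \<Longrightarrow> f (a \<odot>\<^bsub>M\<^esub> x) = a \<odot>\<^bsub>M\<^esub> f x"
  using assms by (auto simp: lin_def)

lemma lin_mono: "lin R M A B f \<Longrightarrow> A' \<subseteq> A \<Longrightarrow> B \<subseteq> B' \<Longrightarrow> lin R M A' B' f"
  unfolding lin_def by (simp add: Pi_iff subset_iff)

lemma lin_comp: "lin R M A B f \<Longrightarrow> lin R M B C g \<Longrightarrow> lin R M A C (\<lambda>x. g (f x))"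
  unfolding lin_def by (simp add: Pi_iff)

lemma lin_zeroD: "lin_zero R M A B \<Longrightarrow> lin R M A B f \<Longrightarrow> x \<in> A \<Longrightarrow> f x = \<zero>\<^bsub>M\<^esub>"
  by (auto simp: lin_zero_def)

lemma proj_familyD:
  assumes "proj_family R M I N p"
  shows "i \<in> I \<Longrightarrow> submodule (N i) R M"
    and "i \<in> I \<Longrightarrow> lin R M (carrier M) (N i) (p i)"
    and "i \<in> I \<Longrightarrow> x \<in> N i \<Longrightarrow> p i x = x"
    and "i \<in> I \<Longrightarrow> j \<in> I \<Longrightarrow> i \<noteq> j \<Longrightarrow> x \<in> N j \<Longrightarrow> p i x = \<zero>\<^bsub>M\<^esub>"
    and "x \<in> carrier M \<Longrightarrow> (\<And>i. i \<in> I \<Longrightarrow> p i x = \<zero>\<^bsub>M\<^esub>) \<Longrightarrow> x = \<zero>\<^bsub>M\<^esub>"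
  using assms unfolding proj_family_def by auto

text \<open>These are the decompositions over which \<open>tau_dim\<close> takes its supremum. Their
  projections are carried along so that a single term can be split further.\<close>

definition tri_decomp ::
    "('a, 'r) ring_scheme \<Rightarrow> ('a, 'b, 'm) module_scheme \<Rightarrow> nat \<Rightarrow> (nat \<Rightarrow> 'b set) \<Rightarrow> (nat \<Rightarrow> 'b \<Rightarrow> 'b) \<Rightarrow> bool"
  where "tri_decomp R M k N p \<longleftrightarrow> proj_family R M {1..k} N p \<and> (\<forall>i\<in>{1..k}. N i \<noteq> {\<zero>\<^bsub>M\<^esub>}) \<and>
      (\<forall>i\<in>{1..k}. \<forall>j\<in>{1..k}. i < j \<longrightarrow> lin_zero R M (N i) (N j))"

context right_module
begin

subsection \<open>Linear maps between submodules\<close>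

lemma smult_zero: "a \<in> carrier R \<Longrightarrow> a \<odot>\<^bsub>M\<^esub> \<zero>\<^bsub>M\<^esub> = \<zero>\<^bsub>M\<^esub>"
  using smult_r_distr[of a "\<zero>\<^bsub>M\<^esub>" "\<zero>\<^bsub>M\<^esub>"] smult_closed[of a "\<zero>\<^bsub>M\<^esub>"]
  by (simp add: M.add.r_cancel_one')

lemma zero_smult: "x \<in> carrier M \<Longrightarrow> \<zero>\<^bsub>R\<^esub> \<odot>\<^bsub>M\<^esub> x = \<zero>\<^bsub>M\<^esub>"
  using smult_l_distr[of "\<zero>\<^bsub>R\<^esub>" "\<zero>\<^bsub>R\<^esub>" x] smult_closed[of "\<zero>\<^bsub>R\<^esub>" x]
  by (simp add: M.add.r_cancel_one')

lemma minus_one_smult: "x \<in> carrier M \<Longrightarrow> (\<ominus>\<^bsub>R\<^esub> \<one>\<^bsub>R\<^esub>) \<odot>\<^bsub>M\<^esub> x = \<ominus>\<^bsub>M\<^esub> x"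
  using smult_l_distr[of "\<ominus>\<^bsub>R\<^esub> \<one>\<^bsub>R\<^esub>" "\<one>\<^bsub>R\<^esub>" x] smult_closed[of "\<ominus>\<^bsub>R\<^esub> \<one>\<^bsub>R\<^esub>" x]
  by (simp add: zero_smult smult_one R.l_neg M.minus_equality)

text \<open>Closure under additive inverses comes for free, since the inverse of \<open>x\<close> is
  the action of the ring element \<open>\<ominus> \<one>\<close> on \<open>x\<close>.\<close>

lemma submodule_iff:
  "submodule H R M \<longleftrightarrow> H \<subseteq> carrier M \<and> \<zero>\<^bsub>M\<^esub> \<in> H \<and>
     (\<forall>x\<in>H. \<forall>y\<in>H. x \<oplus>\<^bsub>M\<^esub> y \<in> H) \<and> (\<forall>a\<in>carrier R. \<forall>x\<in>H. a \<odot>\<^bsub>M\<^esub> x \<in> H)" (is "_ \<longleftrightarrow> ?rhs")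
proof
  assume "submodule H R M"
  then interpret H: submodule H R M .
  show ?rhs
    using H.subset H.one_closed H.m_closed by auto
next
  assume h: ?rhs
  have "\<ominus>\<^bsub>M\<^esub> x \<in> H" if "x \<in> H" for x
    using h that minus_one_smult[of x] R.a_inv_closed[OF R.one_closed] by (metis subsetD)
  then show "submodule H R M"
    using h by (intro submodule.intro subgroup.intro submodule_axioms.intro) (auto simp: a_inv_def)
qed

lemma submoduleD:
  assumes "submodule H R M"
  shows "H \<subseteq> carrier M" "\<zero>\<^bsub>M\<^esub> \<in> H" "x \<in> H \<Longrightarrow> x \<in> carrier M"
    and "x \<in> H \<Longrightarrow> y \<in> H \<Longrightarrow> x \<oplus>\<^bsub>M\<^esub> y \<in> H"
    and "a \<in> carrier R \<Longrightarrow> x \<in> H \<Longrightarrow> a \<odot>\<^bsub>M\<^esub> x \<in> H"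
    and "x \<in> H \<Longrightarrow> \<ominus>\<^bsub>M\<^esub> x \<in> H"
    and "x \<in> H \<Longrightarrow> y \<in> H \<Longrightarrow> x \<ominus>\<^bsub>M\<^esub> y \<in> H"
proof -
  show *: "H \<subseteq> carrier M" "\<zero>\<^bsub>M\<^esub> \<in> H" "x \<in> H \<Longrightarrow> x \<in> carrier M"
    "x \<in> H \<Longrightarrow> y \<in> H \<Longrightarrow> x \<oplus>\<^bsub>M\<^esub> y \<in> H" "a \<in> carrier R \<Longrightarrow> x \<in> H \<Longrightarrow> a \<odot>\<^bsub>M\<^esub> x \<in> H" for x y a
    using assms by (auto simp: submodule_iff)
  show **: "x \<in> H \<Longrightarrow> \<ominus>\<^bsub>M\<^esub> x \<in> H" for x
    using *(3,5) minus_one_smult[of x] R.a_inv_closed[OF R.one_closed] by metis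
  show "x \<in> H \<Longrightarrow> y \<in> H \<Longrightarrow> x \<ominus>\<^bsub>M\<^esub> y \<in> H"
    using * ** by (simp add: M.minus_eq)
qed

lemma carrier_submodule: "submodule (carrier M) R M"
  by (auto simp: submodule_iff smult_closed)

lemma submodule_Int: "submodule A R M \<Longrightarrow> submodule B R M \<Longrightarrow> submodule (A \<inter> B) R M"
  by (auto simp: submodule_iff)

lemma submodule_restrict_iff:
  assumes "submodule N R M"
  shows "submodule A R (M \<restriction>\<^sub>M N) \<longleftrightarrow> submodule A R M \<and> A \<subseteq> N"
proof -
  interpret N: right_module R "M \<restriction>\<^sub>M N" by (rule submodule_is_right_module[OF assms])
  show ?thesis
    using submoduleD(1)[OF assms] unfolding N.submodule_iff submodule_iff by auto
qed

lemma lin_0: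
  assumes "lin R M A B f" "submodule A R M" "submodule B R M"
  shows "f \<zero>\<^bsub>M\<^esub> = \<zero>\<^bsub>M\<^esub>"
proof -
  have z: "\<zero>\<^bsub>M\<^esub> \<in> A" using assms(2) by (rule submoduleD)
  then have "f \<zero>\<^bsub>M\<^esub> \<in> carrier M" using linD(1)[OF assms(1)] submoduleD(3)[OF assms(3)] by auto
  then show ?thesis
    using linD(2)[OF assms(1) z z] by (simp add: M.add.r_cancel_one')
qed

lemma lin_minus:
  assumes "lin R M A B f" "submodule A R M" "submodule B R M" "x \<in> A" "y \<in> A"
  shows "f (x \<ominus>\<^bsub>M\<^esub> y) = f x \<ominus>\<^bsub>M\<^esub> f y"
proof -
  have "f (\<ominus>\<^bsub>M\<^esub> y) = \<ominus>\<^bsub>M\<^esub> f y"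
    using linD(3)[OF assms(1), of "\<ominus>\<^bsub>R\<^esub> \<one>\<^bsub>R\<^esub>" y] assms linD(1)[OF assms(1)]
    by (simp add: minus_one_smult submoduleD(3))
  then show ?thesis
    using linD(2)[OF assms(1), of x "\<ominus>\<^bsub>M\<^esub> y"] submoduleD(6)[OF assms(2)] assms
    by (simp add: M.minus_eq)
qed

lemma minus_eq_zero_iff:
  "x \<in> carrier M \<Longrightarrow> y \<in> carrier M \<Longrightarrow> x \<ominus>\<^bsub>M\<^esub> y = \<zero>\<^bsub>M\<^esub> \<longleftrightarrow> x = y"
  using M.minus_equality[of x "\<ominus>\<^bsub>M\<^esub> y"] by (auto simp: M.minus_eq M.r_neg)

lemma lin_diff:
  assumes "lin R M A B f" "lin R M A B g" "submodule A R M" "submodule B R M"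
  shows "lin R M A B (\<lambda>x. f x \<ominus>\<^bsub>M\<^esub> g x)"
proof -
  have c: "f x \<in> carrier M" "g x \<in> carrier M" if "x \<in> A" for x
    using linD(1)[OF assms(1) that] linD(1)[OF assms(2) that] submoduleD(3)[OF assms(4)] by auto
  show ?thesis
    unfolding lin_def
  proof (intro conjI ballI funcsetI)
    fix x assume x: "x \<in> A"
    then show "f x \<ominus>\<^bsub>M\<^esub> g x \<in> B"
      using linD(1)[OF assms(1)] linD(1)[OF assms(2)] submoduleD(7)[OF assms(4)] by auto
    fix y assume y: "y \<in> A"
    show "f (x \<oplus>\<^bsub>M\<^esub> y) \<ominus>\<^bsub>M\<^esub> g (x \<oplus>\<^bsub>M\<^esub> y) = f x \<ominus>\<^bsub>M\<^esub> g x \<oplus>\<^bsub>M\<^esub> (f y \<ominus>\<^bsub>M\<^esub> g y)"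
      using c x y by (simp add: linD(2)[OF assms(1)] linD(2)[OF assms(2)] M.minus_eq M.minus_add M.a_ac)
  next
    fix a x assume ax: "a \<in> carrier R" "x \<in> A"
    have m: "a \<odot>\<^bsub>M\<^esub> (\<ominus>\<^bsub>M\<^esub> z) = \<ominus>\<^bsub>M\<^esub> (a \<odot>\<^bsub>M\<^esub> z)" if "z \<in> carrier M" for z
      using smult_r_distr[of a "\<ominus>\<^bsub>M\<^esub> z" z] that ax
      by (simp add: M.l_neg smult_zero smult_closed M.minus_equality)
    show "f (a \<odot>\<^bsub>M\<^esub> x) \<ominus>\<^bsub>M\<^esub> g (a \<odot>\<^bsub>M\<^esub> x) = a \<odot>\<^bsub>M\<^esub> (f x \<ominus>\<^bsub>M\<^esub> g x)"
      using c ax m by (simp add: linD(3)[OF assms(1)] linD(3)[OF assms(2)] M.minus_eq smult_r_distr)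
  qed
qed

lemma lin_id: "A \<subseteq> B \<Longrightarrow> lin R M A B (\<lambda>x. x)"
  by (auto simp: lin_def)

lemma lin_const_zero: "submodule B R M \<Longrightarrow> lin R M A B (\<lambda>x. \<zero>\<^bsub>M\<^esub>)"
  by (auto simp: lin_def smult_zero submoduleD)

lemma submodule_kernel:
  assumes "lin R M A B f" "submodule A R M" "submodule B R M"
  shows "submodule {x\<in>A. f x = \<zero>\<^bsub>M\<^esub>} R M"
  using assms submoduleD[OF assms(2)] lin_0[OF assms]
  by (auto simp: submodule_iff smult_zero linD[OF assms(1)])

lemma submodule_image:
  assumes "lin R M A B f" "submodule A R M" "submodule B R M"
  shows "submodule (f ` A) R M"
proof -
  have "\<zero>\<^bsub>M\<^esub> \<in> f ` A" using lin_0[OF assms] submoduleD(2)[OF assms(2)] by force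
  then show ?thesis
    using linD(1)[OF assms(1)] submoduleD[OF assms(2)] submoduleD(3)[OF assms(3)]
    by (auto simp: submodule_iff image_iff)
       (metis linD(2)[OF assms(1)], metis linD(3)[OF assms(1)])
qed

section \<open>Translation of the notions on restricted modules to linear maps between subsets of
  \<open>M\<close>\<close>

lemma Hom_lin: "f \<in> Hom R (M \<restriction>\<^sub>M A) (M \<restriction>\<^sub>M B) \<Longrightarrow> lin R M A B f"
  by (auto simp: Hom_def lin_def)

lemma lin_Hom:
  assumes "lin R M A B f" "submodule A R M"
  shows "restrict f A \<in> Hom R (M \<restriction>\<^sub>M A) (M \<restriction>\<^sub>M B)"
  using assms(1) submoduleD[OF assms(2)] by (auto simp: Hom_def lin_def)

lemma Hom_zero_iff:
  assumes "submodule A R M" "submodule B R M"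
  shows "Hom_zero R (M \<restriction>\<^sub>M A) (M \<restriction>\<^sub>M B) \<longleftrightarrow> lin_zero R M A B"
proof
  assume h: "Hom_zero R (M \<restriction>\<^sub>M A) (M \<restriction>\<^sub>M B)"
  show "lin_zero R M A B"
    unfolding lin_zero_def
  proof (intro allI impI ballI)
    fix f x assume f: "lin R M A B f" and x: "x \<in> A"
    have "restrict f A = (\<lambda>x\<in>A. \<zero>\<^bsub>M\<^esub>)"
      using lin_Hom[OF f assms(1)] h by (simp add: Hom_zero_def)
    from fun_cong[OF this, of x] x show "f x = \<zero>\<^bsub>M\<^esub>" by simp
  qed
next
  assume h: "lin_zero R M A B"
  have "f = (\<lambda>x\<in>A. \<zero>\<^bsub>M\<^esub>)" if f: "f \<in> Hom R (M \<restriction>\<^sub>M A) (M \<restriction>\<^sub>M B)" for f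
    using Hom_lin[OF f] h f by (auto simp: lin_zero_def Hom_def PiE_iff extensional_def)
  moreover have "(\<lambda>x\<in>A. \<zero>\<^bsub>M\<^esub>) \<in> Hom R (M \<restriction>\<^sub>M A) (M \<restriction>\<^sub>M B)"
    using lin_Hom[OF lin_const_zero assms(1), OF assms(2)] .
  ultimately have "Hom R (M \<restriction>\<^sub>M A) (M \<restriction>\<^sub>M B) = {\<lambda>x\<in>A. \<zero>\<^bsub>M\<^esub>}" by blast
  then show "Hom_zero R (M \<restriction>\<^sub>M A) (M \<restriction>\<^sub>M B)" by (simp add: Hom_zero_def)
qed

lemma retractable_iff:
  assumes "submodule D R M"
  shows "retractable R (M \<restriction>\<^sub>M D) \<longleftrightarrow>
    (\<forall>K. submodule K R M \<and> K \<subseteq> D \<and> K \<noteq> {\<zero>\<^bsub>M\<^esub>} \<longrightarrow> \<not> lin_zero R M D K)"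
  unfolding retractable_def using assms
  by (auto simp: submodule_restrict_iff Hom_zero_iff)

text \<open>An embedding into a power of \<open>N\<close> amounts to a family of maps from
  \<open>P\<close> to \<open>N\<close> that together kill only zero: its coordinates form such a
  family, and conversely one suitable map per nonzero element yields an embedding.\<close>

lemma cogenerated_by_iff:
  assumes "submodule P R M" "submodule N R M"
  shows "cogenerated_by R (M \<restriction>\<^sub>M P) (M \<restriction>\<^sub>M N) \<longleftrightarrow>
    (\<forall>x\<in>P. x \<noteq> \<zero>\<^bsub>M\<^esub> \<longrightarrow> (\<exists>h. lin R M P N h \<and> h x \<noteq> \<zero>\<^bsub>M\<^esub>))"
proof
  assume "cogenerated_by R (M \<restriction>\<^sub>M P) (M \<restriction>\<^sub>M N)"
  then obtain I :: "'b set" and f where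
    f: "f \<in> Hom R (M \<restriction>\<^sub>M P) (direct_product I (\<lambda>_. M \<restriction>\<^sub>M N))" and inj: "inj_on f P"
    unfolding cogenerated_by_def by auto
  have l: "lin R M P N (\<lambda>x. f x i)" if "i \<in> I" for i
    using f that submoduleD[OF assms(1)] by (auto simp: Hom_def direct_product_def lin_def PiE_iff)
  show "\<forall>x\<in>P. x \<noteq> \<zero>\<^bsub>M\<^esub> \<longrightarrow> (\<exists>h. lin R M P N h \<and> h x \<noteq> \<zero>\<^bsub>M\<^esub>)"
  proof (intro ballI impI)
    fix x assume x: "x \<in> P" "x \<noteq> \<zero>\<^bsub>M\<^esub>"
    have z: "\<zero>\<^bsub>M\<^esub> \<in> P" using assms by (simp add: submoduleD)
    have ext: "f y \<in> extensional I" if "y \<in> P" for y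
      using f that by (auto simp: Hom_def direct_product_def PiE_iff)
    have "f x \<noteq> f \<zero>\<^bsub>M\<^esub>" using inj x z by (auto simp: inj_on_def)
    then obtain i where "i \<in> I" "f x i \<noteq> f \<zero>\<^bsub>M\<^esub> i"
      using extensionalityI[OF ext[OF x(1)] ext[OF z]] by blast
    then show "\<exists>h. lin R M P N h \<and> h x \<noteq> \<zero>\<^bsub>M\<^esub>"
      using l lin_0[OF l assms] by metis
  qed
next
  assume "\<forall>x\<in>P. x \<noteq> \<zero>\<^bsub>M\<^esub> \<longrightarrow> (\<exists>h. lin R M P N h \<and> h x \<noteq> \<zero>\<^bsub>M\<^esub>)"
  then obtain h where h: "\<And>x. x \<in> P \<Longrightarrow> x \<noteq> \<zero>\<^bsub>M\<^esub> \<Longrightarrow> lin R M P N (h x) \<and> h x x \<noteq> \<zero>\<^bsub>M\<^esub>"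
    by metis
  \<comment> \<open>One coordinate per nonzero element, so that the index set consists of elements
    of the embedded module, as \<open>cogenerated_by\<close> demands.\<close>
  define I where "I = P - {\<zero>\<^bsub>M\<^esub>}"
  have l: "lin R M P N (h i)" if "i \<in> I" for i using that h by (auto simp: I_def)
  define f where "f = (\<lambda>x\<in>P. \<lambda>i\<in>I. h i x)"
  have "f \<in> Hom R (M \<restriction>\<^sub>M P) (direct_product I (\<lambda>_. M \<restriction>\<^sub>M N))"
    using submoduleD[OF assms(1)]
    by (auto simp: Hom_def direct_product_def f_def linD[OF l] fun_eq_iff)
  moreover have "inj_on f P"
  proof (rule inj_onI, rule ccontr)
    fix x y assume xy: "x \<in> P" "y \<in> P" "f x = f y" "x \<noteq> y"
    \<comment> \<open>The difference \<open>z\<close> is itself an index. If \<open>x\<close> and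
      \<open>y\<close> had equal images, the coordinate \<open>h z\<close> would vanish at
      \<open>z\<close>, against its choice.\<close>
    define z where "z = x \<ominus>\<^bsub>M\<^esub> y"
    have z: "z \<in> I"
      using xy submoduleD(3,7)[OF assms(1)] by (auto simp: z_def I_def minus_eq_zero_iff)
    then have "h z x = h z y" using fun_cong[OF xy(3), of z] xy by (simp add: f_def)
    then have "h z z = \<zero>\<^bsub>M\<^esub>"
      using lin_minus[OF l[OF z] assms xy(1,2)] linD(1)[OF l[OF z]] xy submoduleD(3)[OF assms(2)]
      by (simp add: minus_eq_zero_iff flip: z_def)
    then show False using h z by (auto simp: I_def)
  qed
  ultimately show "cogenerated_by R (M \<restriction>\<^sub>M P) (M \<restriction>\<^sub>M N)"
    unfolding cogenerated_by_def by (intro exI bexI) simp_all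
qed

lemma prime_module_iff:
  assumes "submodule P R M"
  shows "prime_module R (M \<restriction>\<^sub>M P) \<longleftrightarrow>
    (\<forall>N. submodule N R M \<and> N \<subseteq> P \<and> N \<noteq> {\<zero>\<^bsub>M\<^esub>} \<longrightarrow>
      (\<forall>x\<in>P. x \<noteq> \<zero>\<^bsub>M\<^esub> \<longrightarrow> (\<exists>h. lin R M P N h \<and> h x \<noteq> \<zero>\<^bsub>M\<^esub>)))"
  unfolding prime_module_def using cogenerated_by_iff[OF assms] submodule_restrict_iff[OF assms]
  by simp

lemma orthogonal_iff:
  assumes "submodule P R M" "submodule Q R M"
  shows "orthogonal_modules R (M \<restriction>\<^sub>M P) (M \<restriction>\<^sub>M Q) \<longleftrightarrow>
    (\<forall>A B f. submodule A R M \<and> A \<subseteq> P \<and> A \<noteq> {\<zero>\<^bsub>M\<^esub>} \<and> submodule B R M \<and> B \<subseteq> Q \<and> B \<noteq> {\<zero>\<^bsub>M\<^esub>} \<and>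
       lin R M A B f \<longrightarrow> \<not> bij_betw f A B)"
proof -
  have "isomorphic_modules R (M \<restriction>\<^sub>M A) (M \<restriction>\<^sub>M B) \<longleftrightarrow> (\<exists>f. lin R M A B f \<and> bij_betw f A B)"
    if "submodule A R M" for A B
  proof
    assume "\<exists>f. lin R M A B f \<and> bij_betw f A B"
    then obtain f where f: "lin R M A B f" "bij_betw f A B" by auto
    have "bij_betw (restrict f A) A B" using f(2) by (simp cong: bij_betw_cong)
    then show "isomorphic_modules R (M \<restriction>\<^sub>M A) (M \<restriction>\<^sub>M B)"
      using lin_Hom[OF f(1) that] unfolding isomorphic_modules_def by (intro bexI) simp_all
  qed (auto simp: isomorphic_modules_def dest: Hom_lin)
  then show ?thesis
    unfolding orthogonal_modules_def using submodule_restrict_iff[OF assms(1)] submodule_restrict_iff[OF assms(2)]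
    by simp blast
qed

subsection \<open>Direct sums as families of projections\<close>

lemma additive_finsum:
  assumes "finite I" "f \<in> I \<rightarrow> carrier M" "g \<in> carrier M \<rightarrow> carrier M" "g \<zero>\<^bsub>M\<^esub> = \<zero>\<^bsub>M\<^esub>"
    and "\<And>x y. x \<in> carrier M \<Longrightarrow> y \<in> carrier M \<Longrightarrow> g (x \<oplus>\<^bsub>M\<^esub> y) = g x \<oplus>\<^bsub>M\<^esub> g y"
  shows "g (\<Oplus>\<^bsub>M\<^esub>i\<in>I. f i) = (\<Oplus>\<^bsub>M\<^esub>i\<in>I. g (f i))"
  using assms(1,2)
proof (induction I)
  case empty
  then show ?case using assms(4) by simp
next
  case (insert i I)
  have c: "f \<in> I \<rightarrow> carrier M" "f i \<in> carrier M" using insert.prems by auto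
  have gc: "(\<lambda>i. g (f i)) \<in> I \<rightarrow> carrier M" "g (f i) \<in> carrier M" using c assms(3) by auto
  show ?case
    using insert c gc by (simp add: M.finsum_insert assms(5))
qed

lemma finsum_delta:
  assumes "finite I" "j \<in> I" "x \<in> carrier M"
  shows "(\<Oplus>\<^bsub>M\<^esub>i\<in>I. if i = j then x else \<zero>\<^bsub>M\<^esub>) = x"
  using M.finsum_singleton[of j I "\<lambda>_. x"] assms by (simp add: eq_commute[of _ j])

text \<open>Each \<open>p j\<close> fixes its own component and kills the others, so it takes the
  same value on \<open>x\<close> and on the sum. Joint injectivity then makes the two equal.\<close>

lemma proj_family_sum:
  assumes pf: "proj_family R M I N p" and fin: "finite I" and x: "x \<in> carrier M"
  shows "x = (\<Oplus>\<^bsub>M\<^esub>i\<in>I. p i x)"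
proof -
  note pfD = proj_familyD[OF pf]
  define y where "y = (\<Oplus>\<^bsub>M\<^esub>i\<in>I. p i x)"
  have pN: "p i z \<in> N i" if "i \<in> I" "z \<in> carrier M" for i z
    using linD(1)[OF pfD(2)] that by auto
  have pc: "p i z \<in> carrier M" if "i \<in> I" "z \<in> carrier M" for i z
    using pN[OF that] submoduleD(3)[OF pfD(1)] that by auto
  have yc: "y \<in> carrier M" unfolding y_def using pc x by (intro M.finsum_closed) auto
  have "p j y = p j x" if j: "j \<in> I" for j
  proof -
    have "p j y = (\<Oplus>\<^bsub>M\<^esub>i\<in>I. p j (p i x))"
      unfolding y_def using pc x j fin
      by (intro additive_finsum) (auto simp: linD(2)[OF pfD(2)] lin_0[OF pfD(2) carrier_submodule pfD(1)])
    also have "\<dots> = (\<Oplus>\<^bsub>M\<^esub>i\<in>I. if i = j then p j x else \<zero>\<^bsub>M\<^esub>)"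
      using j x pN pc pfD(3,4) by (intro M.finsum_cong') auto
    also have "\<dots> = p j x" using fin j x pc by (intro finsum_delta) auto
    finally show ?thesis .
  qed
  then have "p j (x \<ominus>\<^bsub>M\<^esub> y) = \<zero>\<^bsub>M\<^esub>" if "j \<in> I" for j
    using lin_minus[OF pfD(2) carrier_submodule pfD(1), OF that that x yc] that pc[OF that x]
    by (simp add: minus_eq_zero_iff)
  then have "x \<ominus>\<^bsub>M\<^esub> y = \<zero>\<^bsub>M\<^esub>" using x yc by (simp add: pfD(5))
  then show ?thesis using x yc minus_eq_zero_iff y_def by metis
qed

text \<open>Existence is \<open>proj_family_sum\<close>. For uniqueness, applying \<open>p j\<close>
  to any representation of \<open>x\<close> leaves exactly its term at \<open>j\<close>.\<close>

lemma proj_family_direct_sum: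
  assumes pf: "proj_family R M I N p" and fin: "finite I"
  shows "is_direct_sum R M I N"
  unfolding is_direct_sum_def
proof (intro conjI ballI)
  note pfD = proj_familyD[OF pf]
  show "submodule (N i) R M" if "i \<in> I" for i using pfD(1) that .
  fix x assume x: "x \<in> carrier M"
  have pN: "p i z \<in> N i" if "i \<in> I" "z \<in> carrier M" for i z
    using linD(1)[OF pfD(2)] that by auto
  have Nc: "z \<in> carrier M" if "i \<in> I" "z \<in> N i" for i z
    using submoduleD(3)[OF pfD(1)] that by auto
  show "\<exists>!f. f \<in> (\<Pi>\<^sub>E i\<in>I. N i) \<and> x = (\<Oplus>\<^bsub>M\<^esub>i\<in>I. f i)"
  proof (rule ex1I[of _ "\<lambda>i\<in>I. p i x"])
    have "x = (\<Oplus>\<^bsub>M\<^esub>i\<in>I. p i x)" by (rule proj_family_sum[OF pf fin x])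
    also have "\<dots> = (\<Oplus>\<^bsub>M\<^esub>i\<in>I. (\<lambda>i\<in>I. p i x) i)"
      using pN Nc x by (intro M.finsum_cong') auto
    finally show "(\<lambda>i\<in>I. p i x) \<in> (\<Pi>\<^sub>E i\<in>I. N i) \<and> x = (\<Oplus>\<^bsub>M\<^esub>i\<in>I. (\<lambda>i\<in>I. p i x) i)"
      using pN x by auto
  next
    fix f assume f: "f \<in> (\<Pi>\<^sub>E i\<in>I. N i) \<and> x = (\<Oplus>\<^bsub>M\<^esub>i\<in>I. f i)"
    have fN: "f i \<in> N i" "f i \<in> carrier M" if "i \<in> I" for i using f that Nc by auto
    have "p j x = f j" if j: "j \<in> I" for j
    proof -
      have "p j x = p j (\<Oplus>\<^bsub>M\<^esub>i\<in>I. f i)" using f by simp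
      also have "\<dots> = (\<Oplus>\<^bsub>M\<^esub>i\<in>I. p j (f i))"
        using fN j fin Nc pN
        by (intro additive_finsum) (auto simp: linD(2)[OF pfD(2)] lin_0[OF pfD(2) carrier_submodule pfD(1)])
      also have "\<dots> = (\<Oplus>\<^bsub>M\<^esub>i\<in>I. if i = j then f j else \<zero>\<^bsub>M\<^esub>)"
        using j fN pfD(3,4) by (intro M.finsum_cong') auto
      also have "\<dots> = f j" using fin j fN by (intro finsum_delta) auto
      finally show ?thesis .
    qed
    then show "f = (\<lambda>i\<in>I. p i x)" using f by (auto simp: fun_eq_iff PiE_iff extensional_def)
  qed
qed

lemma direct_sum_proj_family:
  assumes ds: "is_direct_sum R M I N" and fin: "finite I"
  obtains p where "proj_family R M I N p"
proof -
  have sN: "submodule (N i) R M" if "i \<in> I" for i using ds that by (auto simp: is_direct_sum_def)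
  have Nc: "z \<in> carrier M" if "i \<in> I" "z \<in> N i" for i z
    using submoduleD(3)[OF sN] that by auto
  have "\<forall>x\<in>carrier M. \<exists>f. f \<in> (\<Pi>\<^sub>E i\<in>I. N i) \<and> x = (\<Oplus>\<^bsub>M\<^esub>i\<in>I. f i)"
    using ds unfolding is_direct_sum_def by blast
  then obtain f where f: "\<And>x. x \<in> carrier M \<Longrightarrow> f x \<in> (\<Pi>\<^sub>E i\<in>I. N i) \<and> x = (\<Oplus>\<^bsub>M\<^esub>i\<in>I. f x i)"
    by metis
  \<comment> \<open>Additivity, compatibility with the action and the values on the components all
    follow from this: once a representation with terms in the components is exhibited, its terms are
    the coordinates.\<close>
  have uniq: "f x i = g i" if "x \<in> carrier M" "\<And>i. i \<in> I \<Longrightarrow> g i \<in> N i" "x = (\<Oplus>\<^bsub>M\<^esub>i\<in>I. g i)" "i \<in> I" for x g i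
  proof -
    have "(\<Oplus>\<^bsub>M\<^esub>i\<in>I. g i) = (\<Oplus>\<^bsub>M\<^esub>i\<in>I. restrict g I i)"
      using that(2) Nc by (intro M.finsum_cong') auto
    then have "restrict g I \<in> (\<Pi>\<^sub>E i\<in>I. N i) \<and> x = (\<Oplus>\<^bsub>M\<^esub>i\<in>I. restrict g I i)"
      using that by auto
    then have "f x = restrict g I" using f[OF that(1)] ds that(1) unfolding is_direct_sum_def by blast
    then show ?thesis using that by simp
  qed
  have fN: "f x i \<in> N i" if "x \<in> carrier M" "i \<in> I" for x i using f that by auto
  have fc: "f x i \<in> carrier M" if "x \<in> carrier M" "i \<in> I" for x i using fN Nc that by auto
  define p where "p i x = f x i" for i x
  have "proj_family R M I N p"
    unfolding proj_family_def
  proof (intro conjI ballI impI)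
    fix i assume i: "i \<in> I"
    show "submodule (N i) R M" by (rule sN[OF i])
    show "lin R M (carrier M) (N i) (p i)"
      unfolding lin_def p_def
    proof (intro conjI ballI funcsetI)
      fix x assume x: "x \<in> carrier M"
      show "f x i \<in> N i" by (rule fN[OF x i])
      fix y assume y: "y \<in> carrier M"
      show "f (x \<oplus>\<^bsub>M\<^esub> y) i = f x i \<oplus>\<^bsub>M\<^esub> f y i"
      proof (rule uniq)
        have "x \<oplus>\<^bsub>M\<^esub> y = (\<Oplus>\<^bsub>M\<^esub>i\<in>I. f x i) \<oplus>\<^bsub>M\<^esub> (\<Oplus>\<^bsub>M\<^esub>i\<in>I. f y i)" using f x y by metis
        then show "x \<oplus>\<^bsub>M\<^esub> y = (\<Oplus>\<^bsub>M\<^esub>i\<in>I. f x i \<oplus>\<^bsub>M\<^esub> f y i)"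
          using fc x y by (simp add: M.finsum_addf Pi_def)
      qed (use x y i fN submoduleD(4)[OF sN] in auto)
    next
      fix a x assume a: "a \<in> carrier R" and x: "x \<in> carrier M"
      show "f (a \<odot>\<^bsub>M\<^esub> x) i = a \<odot>\<^bsub>M\<^esub> f x i"
      proof (rule uniq)
        have "a \<odot>\<^bsub>M\<^esub> x = a \<odot>\<^bsub>M\<^esub> (\<Oplus>\<^bsub>M\<^esub>i\<in>I. f x i)" using f x by metis
        also have "\<dots> = (\<Oplus>\<^bsub>M\<^esub>i\<in>I. a \<odot>\<^bsub>M\<^esub> f x i)"
          using fin fc x a by (intro additive_finsum) (auto simp: smult_closed smult_zero smult_r_distr)
        finally show "a \<odot>\<^bsub>M\<^esub> x = (\<Oplus>\<^bsub>M\<^esub>i\<in>I. a \<odot>\<^bsub>M\<^esub> f x i)" .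
      qed (use x a i fN submoduleD(5)[OF sN] smult_closed in auto)
    qed
  next
    fix i j x assume ij: "i \<in> I" "j \<in> I" and x: "x \<in> N j"
    have "f x i = (if i = j then x else \<zero>\<^bsub>M\<^esub>)"
      using ij x Nc submoduleD(2)[OF sN] by (intro uniq) (auto simp: finsum_delta fin)
    then show "p i x = (if i = j then x else \<zero>\<^bsub>M\<^esub>)" by (simp add: p_def)
  next
    fix x assume x: "x \<in> carrier M" and 0: "\<forall>i\<in>I. p i x = \<zero>\<^bsub>M\<^esub>"
    have "x = (\<Oplus>\<^bsub>M\<^esub>i\<in>I. f x i)" using f x by blast
    also have "\<dots> = (\<Oplus>\<^bsub>M\<^esub>i\<in>I. \<zero>\<^bsub>M\<^esub>)" using 0 by (intro M.finsum_cong') (auto simp: p_def)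
    finally show "x = \<zero>\<^bsub>M\<^esub>" by (simp add: M.finsum_zero)
  qed
  then show ?thesis by (rule that)
qed

section \<open>Direct summands and components described by projections\<close>

lemma direct_summand_projection:
  assumes "direct_summand R M D"
  obtains e where "submodule D R M" "lin R M (carrier M) D e" "\<And>x. x \<in> D \<Longrightarrow> e x = x"
proof -
  obtain K where D: "submodule D R M" and K: "submodule K R M"
    and sum: "D <+>\<^bsub>M\<^esub> K = carrier M" and int: "D \<inter> K = {\<zero>\<^bsub>M\<^esub>}"
    using assms by (auto simp: direct_summand_def)
  have "\<forall>x\<in>carrier M. \<exists>d. d \<in> D \<and> x \<ominus>\<^bsub>M\<^esub> d \<in> K"
  proof
    fix x assume "x \<in> carrier M"
    then obtain d k where dk: "d \<in> D" "k \<in> K" "x = d \<oplus>\<^bsub>M\<^esub> k"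
      unfolding sum[symmetric] set_add_def' by auto
    then have "d \<in> carrier M" "k \<in> carrier M" using D K by (auto intro: submoduleD)
    then have "x \<ominus>\<^bsub>M\<^esub> d = k"
      using dk(3) by (simp add: M.minus_eq M.a_comm[of d] M.a_assoc M.r_neg)
    then show "\<exists>d. d \<in> D \<and> x \<ominus>\<^bsub>M\<^esub> d \<in> K" using dk by auto
  qed
  \<comment> \<open>\<open>e\<close> will be the projection along the complement \<open>K\<close>:
    \<open>e x\<close> is the element of \<open>D\<close> that differs from \<open>x\<close> by an
    element of \<open>K\<close>.\<close>
  then obtain e where e: "\<And>x. x \<in> carrier M \<Longrightarrow> e x \<in> D \<and> x \<ominus>\<^bsub>M\<^esub> e x \<in> K" by metis
  have uniq: "e x = d" if "x \<in> carrier M" "d \<in> D" "x \<ominus>\<^bsub>M\<^esub> d \<in> K" for x d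
  proof -
    have c: "e x \<in> carrier M" "d \<in> carrier M" using e that D by (auto intro: submoduleD)
    \<comment> \<open>The difference of \<open>e x\<close> and \<open>d\<close> is also a difference
      of two elements of \<open>K\<close>, hence lies in the intersection of \<open>D\<close> and
      \<open>K\<close>.\<close>
    have "(x \<ominus>\<^bsub>M\<^esub> d) \<ominus>\<^bsub>M\<^esub> (x \<ominus>\<^bsub>M\<^esub> e x) = x \<oplus>\<^bsub>M\<^esub> ((e x \<ominus>\<^bsub>M\<^esub> d) \<oplus>\<^bsub>M\<^esub> \<ominus>\<^bsub>M\<^esub> x)"
      using c that(1) by (simp add: M.minus_eq M.minus_add M.a_ac)
    also have "\<dots> = e x \<ominus>\<^bsub>M\<^esub> d"
      using c that(1) by (simp add: M.a_lcomm[of x] M.r_neg)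
    finally have "(x \<ominus>\<^bsub>M\<^esub> d) \<ominus>\<^bsub>M\<^esub> (x \<ominus>\<^bsub>M\<^esub> e x) = e x \<ominus>\<^bsub>M\<^esub> d" .
    then have "e x \<ominus>\<^bsub>M\<^esub> d \<in> K" using submoduleD(7)[OF K that(3)] e[OF that(1)] by metis
    moreover have "e x \<ominus>\<^bsub>M\<^esub> d \<in> D" using submoduleD(7)[OF D] e that by auto
    ultimately have "e x \<ominus>\<^bsub>M\<^esub> d = \<zero>\<^bsub>M\<^esub>" using int by blast
    then show ?thesis using c by (simp add: minus_eq_zero_iff)
  qed
  have Dc: "z \<in> carrier M" if "z \<in> D" for z using that D by (auto intro: submoduleD)
  have ec: "e x \<in> carrier M" if "x \<in> carrier M" for x using e[OF that] Dc by auto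
  have "lin R M (carrier M) D e"
    unfolding lin_def
  proof (intro conjI ballI funcsetI)
    fix x assume x: "x \<in> carrier M"
    show "e x \<in> D" using e x by auto
    fix y assume y: "y \<in> carrier M"
    have "(x \<oplus>\<^bsub>M\<^esub> y) \<ominus>\<^bsub>M\<^esub> (e x \<oplus>\<^bsub>M\<^esub> e y) = (x \<ominus>\<^bsub>M\<^esub> e x) \<oplus>\<^bsub>M\<^esub> (y \<ominus>\<^bsub>M\<^esub> e y)"
      using ec x y by (simp add: M.minus_eq M.minus_add M.a_ac)
    then show "e (x \<oplus>\<^bsub>M\<^esub> y) = e x \<oplus>\<^bsub>M\<^esub> e y"
      using e[OF x] e[OF y] submoduleD(4)[OF D] submoduleD(4)[OF K] x y by (intro uniq) auto
  next
    fix a x assume a: "a \<in> carrier R" and x: "x \<in> carrier M"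
    have "a \<odot>\<^bsub>M\<^esub> x = a \<odot>\<^bsub>M\<^esub> (x \<ominus>\<^bsub>M\<^esub> e x) \<oplus>\<^bsub>M\<^esub> a \<odot>\<^bsub>M\<^esub> e x"
      using a x ec[OF x] by (simp add: M.minus_eq M.a_assoc M.l_neg flip: smult_r_distr)
    then have "a \<odot>\<^bsub>M\<^esub> x \<ominus>\<^bsub>M\<^esub> a \<odot>\<^bsub>M\<^esub> e x = a \<odot>\<^bsub>M\<^esub> (x \<ominus>\<^bsub>M\<^esub> e x)"
      using a x ec[OF x] by (simp add: smult_closed M.minus_eq M.a_assoc M.r_neg)
    then show "e (a \<odot>\<^bsub>M\<^esub> x) = a \<odot>\<^bsub>M\<^esub> e x"
      using e[OF x] a x submoduleD(5)[OF D] submoduleD(5)[OF K] by (intro uniq) (auto simp: smult_closed)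
  qed
  moreover have "e x = x" if "x \<in> D" for x
    using that Dc submoduleD(2)[OF K] by (intro uniq) (auto simp: M.minus_eq M.r_neg)
  ultimately show ?thesis using that D by blast
qed

text \<open>The kernel of \<open>e\<close> is a complement, because \<open>x\<close> is the sum of
  \<open>e x\<close> and \<open>x \<ominus> e x\<close>, and \<open>e\<close> kills the
  latter.\<close>

lemma projection_direct_summand:
  assumes D: "submodule D R M" and e: "lin R M (carrier M) D e" and id: "\<And>x. x \<in> D \<Longrightarrow> e x = x"
  shows "direct_summand R M D"
proof -
  define K where "K = {x\<in>carrier M. e x = \<zero>\<^bsub>M\<^esub>}"
  have K: "submodule K R M" unfolding K_def by (rule submodule_kernel[OF e carrier_submodule D])
  have Dc: "z \<in> carrier M" if "z \<in> D" for z using that D by (auto intro: submoduleD)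
  have "x \<in> D <+>\<^bsub>M\<^esub> K" if x: "x \<in> carrier M" for x
  proof -
    have ex: "e x \<in> D" "e x \<in> carrier M" using linD(1)[OF e x] Dc by auto
    have "e (x \<ominus>\<^bsub>M\<^esub> e x) = \<zero>\<^bsub>M\<^esub>"
      using lin_minus[OF e carrier_submodule D x ex(2)] ex id by (simp add: minus_eq_zero_iff)
    then have "x \<ominus>\<^bsub>M\<^esub> e x \<in> K" using x ex by (auto simp: K_def)
    moreover have "x = e x \<oplus>\<^bsub>M\<^esub> (x \<ominus>\<^bsub>M\<^esub> e x)"
      using x ex by (simp add: M.minus_eq M.a_ac M.r_neg)
    ultimately show ?thesis using ex unfolding set_add_def' by blast
  qed
  then have "D <+>\<^bsub>M\<^esub> K = carrier M" using Dc K unfolding set_add_def' by (auto intro: submoduleD)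
  moreover have "D \<inter> K = {\<zero>\<^bsub>M\<^esub>}"
    using id submoduleD(2)[OF D] submoduleD(2)[OF K] by (auto simp: K_def)
  ultimately show ?thesis using D K by (auto simp: direct_summand_def)
qed

text \<open>All projections agree on \<open>x\<close> and \<open>p i x\<close>, so joint injectivity
  gives \<open>x = p i x\<close>.\<close>

lemma proj_family_component:
  assumes pf: "proj_family R M I N p" and x: "x \<in> carrier M" and i: "i \<in> I"
    and z: "\<And>j. j \<in> I \<Longrightarrow> j \<noteq> i \<Longrightarrow> p j x = \<zero>\<^bsub>M\<^esub>"
  shows "x \<in> N i"
proof -
  note pfD = proj_familyD[OF pf]
  have pi: "p i x \<in> N i" using linD(1)[OF pfD(2)] i x by auto
  then have pc: "p i x \<in> carrier M" using submoduleD(3)[OF pfD(1)] i by auto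
  have "p j (x \<ominus>\<^bsub>M\<^esub> p i x) = \<zero>\<^bsub>M\<^esub>" if j: "j \<in> I" for j
  proof -
    have "p j (p i x) = p j x" using pfD(3,4) i j pi z by (cases "j = i") auto
    moreover have "p j x \<in> carrier M" using linD(1)[OF pfD(2)] submoduleD(3)[OF pfD(1)] j x by blast
    ultimately show ?thesis
      using lin_minus[OF pfD(2) carrier_submodule pfD(1), OF j j x pc] by (simp add: minus_eq_zero_iff)
  qed
  then have "x \<ominus>\<^bsub>M\<^esub> p i x = \<zero>\<^bsub>M\<^esub>" using x pc by (simp add: pfD(5))
  then show ?thesis using pi x pc by (simp add: minus_eq_zero_iff)
qed

lemma proj_family_nonzero:
  assumes "proj_family R M I N p" "x \<in> carrier M" "x \<noteq> \<zero>\<^bsub>M\<^esub>"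
  obtains i where "i \<in> I" "p i x \<noteq> \<zero>\<^bsub>M\<^esub>"
  using proj_familyD(5)[OF assms(1,2)] assms(3) by blast

lemma nontrivial_submodule:
  assumes "submodule K R M" "K \<noteq> {\<zero>\<^bsub>M\<^esub>}"
  obtains x where "x \<in> K" "x \<noteq> \<zero>\<^bsub>M\<^esub>"
  using assms submoduleD(2)[OF assms(1)] by blast

text \<open>For \<open>j\<close> other than \<open>i\<close>, following \<open>g\<close> by
  \<open>p j\<close> gives a map from \<open>N i\<close> to \<open>N j\<close>, which must vanish.
  So \<open>g x\<close> has only its component at \<open>i\<close>.\<close>

lemma fully_invariant_component:
  assumes pf: "proj_family R M I N p" and i: "i \<in> I"
    and hz: "\<And>j. j \<in> I \<Longrightarrow> i \<noteq> j \<Longrightarrow> lin_zero R M (N i) (N j)"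
    and g: "lin R M (carrier M) (carrier M) g" and x: "x \<in> N i"
  shows "g x \<in> N i"
proof (rule proj_family_component[OF pf _ i])
  note pfD = proj_familyD[OF pf]
  have Nc: "N i \<subseteq> carrier M" using submoduleD(1)[OF pfD(1)[OF i]] .
  show "g x \<in> carrier M" using linD(1)[OF g] x Nc by auto
  fix j assume j: "j \<in> I" "j \<noteq> i"
  have "lin R M (N i) (N j) (\<lambda>x. p j (g x))"
    by (rule lin_mono[OF lin_comp[OF g pfD(2)[OF j(1)]] Nc order_refl])
  then show "p j (g x) = \<zero>\<^bsub>M\<^esub>" using lin_zeroD[OF hz] j x by auto
qed

subsection \<open>Prime decompositions\<close>

text \<open>Every triangular term \<open>L l\<close> is assigned a component \<open>N (c l)\<close>
  on which \<open>q l\<close> does not vanish. Two terms cannot share a component, so the assignment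
  \<open>c\<close> is injective.\<close>

lemma prime_decomposition_bound:
  fixes L :: "'j::linorder \<Rightarrow> 'b set"
  assumes pf: "proj_family R M I N p" and "finite I"
    and pr: "\<And>i. i \<in> I \<Longrightarrow> prime_module R (M \<restriction>\<^sub>M N i)"
    and hz: "\<And>i j. i \<in> I \<Longrightarrow> j \<in> I \<Longrightarrow> i \<noteq> j \<Longrightarrow> lin_zero R M (N i) (N j)"
    and qf: "proj_family R M J L q"
    and nz: "\<And>l. l \<in> J \<Longrightarrow> L l \<noteq> {\<zero>\<^bsub>M\<^esub>}"
    and tri: "\<And>s l. s \<in> J \<Longrightarrow> l \<in> J \<Longrightarrow> s < l \<Longrightarrow> lin_zero R M (L s) (L l)"
  shows "card J \<le> card I"
proof -
  note pfD = proj_familyD[OF pf] and qfD = proj_familyD[OF qf]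
  have qM: "lin R M (carrier M) (carrier M) (q l)" if "l \<in> J" for l
    using lin_mono[OF qfD(2) order_refl] that submoduleD(1)[OF qfD(1)] by auto
  have qi: "q l x \<in> N i" if "l \<in> J" "i \<in> I" "x \<in> N i" for l i x
    using fully_invariant_component[OF pf _ hz qM] that by auto
  have Nc: "x \<in> carrier M" if "i \<in> I" "x \<in> N i" for i x
    using submoduleD(3)[OF pfD(1)] that by auto
  \<comment> \<open>Full invariance puts \<open>q l y\<close> into both \<open>N i\<close> and
    \<open>L l\<close>, so primeness of \<open>N i\<close> gives a map \<open>h\<close> into the
    intersection that does not kill \<open>q s x\<close>. Precomposed with \<open>p i\<close> it
    becomes a map from \<open>L s\<close> to \<open>L l\<close> that is nonzero at
    \<open>q s x\<close>, contrary to \<open>tri\<close>.\<close>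
  have order: False if s: "s \<in> J" "l \<in> J" "s < l" "i \<in> I"
    and xy: "x \<in> N i" "y \<in> N i" "q s x \<noteq> \<zero>\<^bsub>M\<^esub>" "q l y \<noteq> \<zero>\<^bsub>M\<^esub>" for s l i x y
  proof -
    have sub: "submodule (N i \<inter> L l) R M" using submodule_Int pfD(1) qfD(1) s by auto
    have "q l y \<in> N i \<inter> L l" using qi s xy linD(1)[OF qfD(2)] Nc by auto
    then have "N i \<inter> L l \<noteq> {\<zero>\<^bsub>M\<^esub>}" using xy by auto
    then obtain h where h: "lin R M (N i) (N i \<inter> L l) h" "h (q s x) \<noteq> \<zero>\<^bsub>M\<^esub>"
      using pr[OF s(4)] sub qi[OF s(1,4) xy(1)] xy(3)
      unfolding prime_module_iff[OF pfD(1)[OF s(4)]] by blast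
    have "lin R M (L s) (L l) (\<lambda>x. h (p i x))"
      using lin_mono[OF lin_comp[OF pfD(2)[OF s(4)] h(1)]] submoduleD(1)[OF qfD(1)[OF s(1)]] by blast
    moreover have "q s x \<in> L s" using linD(1)[OF qfD(2)] s Nc xy by auto
    ultimately have "h (p i (q s x)) = \<zero>\<^bsub>M\<^esub>" using lin_zeroD[OF tri] s by blast
    then show False using h(2) pfD(3)[OF s(4)] qi[OF s(1,4) xy(1)] by simp
  qed
  \<comment> \<open>A nonzero \<open>z\<close> in \<open>L l\<close> is fixed by \<open>q l\<close>
    and is the sum of its components \<open>p i z\<close>, so \<open>q l\<close> cannot vanish on
    all of the \<open>N i\<close>.\<close>
  have "\<exists>i x. i \<in> I \<and> x \<in> N i \<and> q l x \<noteq> \<zero>\<^bsub>M\<^esub>" if l: "l \<in> J" for l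
  proof (rule ccontr)
    assume no: "\<nexists>i x. i \<in> I \<and> x \<in> N i \<and> q l x \<noteq> \<zero>\<^bsub>M\<^esub>"
    obtain z where z: "z \<in> L l" "z \<noteq> \<zero>\<^bsub>M\<^esub>" using nontrivial_submodule[OF qfD(1)[OF l] nz[OF l]] .
    have zc: "z \<in> carrier M" using submoduleD(3)[OF qfD(1)[OF l] z(1)] .
    have "q l (\<Oplus>\<^bsub>M\<^esub>i\<in>I. p i z) = (\<Oplus>\<^bsub>M\<^esub>i\<in>I. q l (p i z))"
      using Nc linD(1)[OF pfD(2)] zc linD(1)[OF qM[OF l]]
      by (intro additive_finsum[OF \<open>finite I\<close>])
         (auto simp: linD(2)[OF qM[OF l]] lin_0[OF qM[OF l] carrier_submodule carrier_submodule])
    also have "\<dots> = (\<Oplus>\<^bsub>M\<^esub>i\<in>I. \<zero>\<^bsub>M\<^esub>)"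
      using no linD(1)[OF pfD(2)] zc by (intro M.finsum_cong') auto
    finally have "q l z = \<zero>\<^bsub>M\<^esub>"
      using proj_family_sum[OF pf \<open>finite I\<close> zc] by (simp add: M.finsum_zero)
    then show False using qfD(3)[OF l z(1)] z(2) by simp
  qed
  then obtain c x where c: "\<And>l. l \<in> J \<Longrightarrow> c l \<in> I \<and> x l \<in> N (c l) \<and> q l (x l) \<noteq> \<zero>\<^bsub>M\<^esub>" by metis
  have "inj_on c J"
  proof (rule inj_onI, rule ccontr)
    fix s l assume sl: "s \<in> J" "l \<in> J" "c s = c l" "s \<noteq> l"
    show False
      using order[of s l "c s" "x s" "x l"] order[of l s "c s" "x l" "x s"] c[OF sl(1)] c[OF sl(2)] sl
      by (metis linorder_neqE)
  qed
  then show ?thesis using c \<open>finite I\<close> by (intro card_inj_on_le) auto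
qed

text \<open>Take a nonzero \<open>H\<close> inside \<open>K\<close> on which the fewest projections
  are nonzero. Minimality makes each of these injective on \<open>H\<close>, so two of them would
  embed \<open>H\<close> into two different components, against orthogonality.\<close>

lemma orthogonal_component:
  assumes pf: "proj_family R M I N p" and fin: "finite I"
    and orth: "\<And>i j. i \<in> I \<Longrightarrow> j \<in> I \<Longrightarrow> i \<noteq> j \<Longrightarrow> orthogonal_modules R (M \<restriction>\<^sub>M N i) (M \<restriction>\<^sub>M N j)"
    and K: "submodule K R M" "K \<noteq> {\<zero>\<^bsub>M\<^esub>}"
  obtains i where "i \<in> I" "K \<inter> N i \<noteq> {\<zero>\<^bsub>M\<^esub>}"
proof -
  note pfD = proj_familyD[OF pf]
  define supp where "supp H = {i\<in>I. \<exists>x\<in>H. p i x \<noteq> \<zero>\<^bsub>M\<^esub>}" for H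
  obtain H where H: "submodule H R M" "H \<noteq> {\<zero>\<^bsub>M\<^esub>}" "H \<subseteq> K"
    and min: "\<And>H'. submodule H' R M \<Longrightarrow> H' \<noteq> {\<zero>\<^bsub>M\<^esub>} \<Longrightarrow> H' \<subseteq> K \<Longrightarrow> card (supp H) \<le> card (supp H')"
    using K
      ex_has_least_nat[of "\<lambda>H. submodule H R M \<and> H \<noteq> {\<zero>\<^bsub>M\<^esub>} \<and> H \<subseteq> K" K "\<lambda>H. card (supp H)"]
    by blast
  have Hc: "x \<in> carrier M" if "x \<in> H" for x using submoduleD(3)[OF H(1) that] .
  obtain x where x: "x \<in> H" "x \<noteq> \<zero>\<^bsub>M\<^esub>" using nontrivial_submodule[OF H(1,2)] .
  obtain i where i: "i \<in> I" "p i x \<noteq> \<zero>\<^bsub>M\<^esub>" using proj_family_nonzero[OF pf Hc[OF x(1)] x(2)] .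
  have l: "lin R M H (N i) (p i)" if "i \<in> I" for i
    using lin_mono[OF pfD(2)[OF that] submoduleD(1)[OF H(1)] order_refl] .
  \<comment> \<open>The kernel of \<open>p j\<close> on \<open>H\<close> loses the index
    \<open>j\<close> from its support; were it nonzero, it would contradict the minimality of
    \<open>H\<close>.\<close>
  have ker: "y = \<zero>\<^bsub>M\<^esub>" if j: "j \<in> supp H" and y: "y \<in> H" "p j y = \<zero>\<^bsub>M\<^esub>" for j y
  proof (rule ccontr)
    assume y0: "y \<noteq> \<zero>\<^bsub>M\<^esub>"
    have jI: "j \<in> I" using j by (auto simp: supp_def)
    define H' where "H' = {x\<in>H. p j x = \<zero>\<^bsub>M\<^esub>}"
    have "submodule H' R M" unfolding H'_def by (rule submodule_kernel[OF l[OF jI] H(1) pfD(1)[OF jI]])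
    moreover have "H' \<noteq> {\<zero>\<^bsub>M\<^esub>}" using y y0 by (auto simp: H'_def)
    ultimately have "card (supp H) \<le> card (supp H')" using H(3) by (intro min) (auto simp: H'_def)
    moreover have "supp H' \<subset> supp H" using j by (auto simp: supp_def H'_def)
    then have "card (supp H') < card (supp H)"
      using fin by (intro psubset_card_mono) (auto simp: supp_def)
    ultimately show False by simp
  qed
  have inj: "inj_on (p j) H" if j: "j \<in> supp H" for j
  proof (rule inj_onI)
    fix y z assume yz: "y \<in> H" "z \<in> H" "p j y = p j z"
    have jI: "j \<in> I" using j by (auto simp: supp_def)
    have "p j (y \<ominus>\<^bsub>M\<^esub> z) = \<zero>\<^bsub>M\<^esub>"
      using lin_minus[OF l[OF jI] H(1) pfD(1)[OF jI] yz(1,2)] yz linD(1)[OF l[OF jI]] submoduleD(3)[OF pfD(1)[OF jI]]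
      by (simp add: minus_eq_zero_iff)
    then have "y \<ominus>\<^bsub>M\<^esub> z = \<zero>\<^bsub>M\<^esub>" using ker[OF j] submoduleD(7)[OF H(1)] yz by auto
    then show "y = z" using yz Hc by (simp add: minus_eq_zero_iff)
  qed
  have "p j x = \<zero>\<^bsub>M\<^esub>" if j: "j \<in> I" "j \<noteq> i" for j
  proof (rule ccontr)
    assume pj: "p j x \<noteq> \<zero>\<^bsub>M\<^esub>"
    have si: "i \<in> supp H" "j \<in> supp H" using i j pj x by (auto simp: supp_def)
    \<comment> \<open>The isomorphism between the two images of \<open>H\<close>: go back along
      \<open>p i\<close>, which is injective on \<open>H\<close>, then apply
      \<open>p j\<close>.\<close>
    define f where "f y = p j (inv_into H (p i) y)" for y
    have f: "f (p i y) = p j y" if "y \<in> H" for y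
      using inv_into_f_f[OF inj[OF si(1)] that] by (simp add: f_def)
    have "lin R M (p i ` H) (p j ` H) f"
      unfolding lin_def
    proof (intro conjI ballI funcsetI)
      fix y assume "y \<in> p i ` H"
      then obtain u where u: "u \<in> H" "y = p i u" by auto
      show "f y \<in> p j ` H" using u f by auto
      fix z assume "z \<in> p i ` H"
      then obtain v where v: "v \<in> H" "z = p i v" by auto
      show "f (y \<oplus>\<^bsub>M\<^esub> z) = f y \<oplus>\<^bsub>M\<^esub> f z"
        using f[of "u \<oplus>\<^bsub>M\<^esub> v"] u v f submoduleD(4)[OF H(1)] linD(2)[OF l[OF i(1)]] linD(2)[OF l[OF j(1)]]
        by simp
    next
      fix a y assume a: "a \<in> carrier R" and "y \<in> p i ` H"
      then obtain u where u: "u \<in> H" "y = p i u" by auto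
      show "f (a \<odot>\<^bsub>M\<^esub> y) = a \<odot>\<^bsub>M\<^esub> f y"
        using f[of "a \<odot>\<^bsub>M\<^esub> u"] u a f submoduleD(5)[OF H(1)] linD(3)[OF l[OF i(1)]] linD(3)[OF l[OF j(1)]]
        by simp
    qed
    moreover have "bij_betw f (p i ` H) (p j ` H)"
    proof -
      have "inj_on f (p i ` H)"
        using inj[OF si(2)] f by (auto simp: inj_on_def)
      moreover have "f ` p i ` H = p j ` H" using f by (auto simp: image_iff)
      ultimately show ?thesis by (simp add: bij_betw_def)
    qed
    moreover have "submodule (p i ` H) R M" "submodule (p j ` H) R M"
      using submodule_image[OF l H(1) pfD(1)] i j by auto
    moreover have "p i ` H \<subseteq> N i" "p j ` H \<subseteq> N j" using linD(1)[OF l] i j by auto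
    moreover have "p i ` H \<noteq> {\<zero>\<^bsub>M\<^esub>}" "p j ` H \<noteq> {\<zero>\<^bsub>M\<^esub>}" using i(2) pj x(1) by auto
    ultimately show False
      using orth[OF i(1) j(1)] j(2) unfolding orthogonal_iff[OF pfD(1)[OF i(1)] pfD(1)[OF j(1)]]
      by blast
  qed
  then have "x \<in> N i" using proj_family_component[OF pf Hc[OF x(1)] i(1)] by auto
  then have "K \<inter> N i \<noteq> {\<zero>\<^bsub>M\<^esub>}" using x H(3) by auto
  then show ?thesis using that i(1) by blast
qed

text \<open>\<open>K\<close> meets some \<open>N i\<close> nontrivially, and primeness of
  \<open>N i\<close> gives a nonzero map \<open>h\<close> from \<open>N i\<close> into this
  intersection. Restricting \<open>h\<close> after \<open>p i\<close> to \<open>D\<close> gives the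
  required map.\<close>

lemma prime_decomposition_retractable:
  assumes pf: "proj_family R M I N p" and fin: "finite I"
    and pr: "\<And>i. i \<in> I \<Longrightarrow> prime_module R (M \<restriction>\<^sub>M N i)"
    and orth: "\<And>i j. i \<in> I \<Longrightarrow> j \<in> I \<Longrightarrow> i \<noteq> j \<Longrightarrow> orthogonal_modules R (M \<restriction>\<^sub>M N i) (M \<restriction>\<^sub>M N j)"
    and D: "submodule D R M"
  shows "retractable R (M \<restriction>\<^sub>M D)"
  unfolding retractable_iff[OF D]
proof (intro allI impI, elim conjE)
  note pfD = proj_familyD[OF pf]
  fix K assume K: "submodule K R M" "K \<subseteq> D" "K \<noteq> {\<zero>\<^bsub>M\<^esub>}"
  obtain i where i: "i \<in> I" "K \<inter> N i \<noteq> {\<zero>\<^bsub>M\<^esub>}" using orthogonal_component[OF pf fin orth K(1,3)] by blast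
  have s: "submodule (K \<inter> N i) R M" using submodule_Int[OF K(1) pfD(1)[OF i(1)]] .
  \<comment> \<open>Choosing \<open>z\<close> in the intersection puts it into \<open>D\<close> and
    makes \<open>p i\<close> fix it, so the composite is nonzero on \<open>D\<close> itself.\<close>
  obtain z where z: "z \<in> K \<inter> N i" "z \<noteq> \<zero>\<^bsub>M\<^esub>" using nontrivial_submodule[OF s i(2)] .
  then obtain h where h: "lin R M (N i) (K \<inter> N i) h" "h z \<noteq> \<zero>\<^bsub>M\<^esub>"
    using pr[OF i(1)] s i(2) unfolding prime_module_iff[OF pfD(1)[OF i(1)]] by blast
  have "lin R M D K (\<lambda>x. h (p i x))"
    using lin_mono[OF lin_comp[OF pfD(2)[OF i(1)] h(1)] submoduleD(1)[OF D]] by blast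
  moreover have "h (p i z) \<noteq> \<zero>\<^bsub>M\<^esub>" using pfD(3)[OF i(1)] z h(2) by auto
  ultimately show "\<not> lin_zero R M D K" using z K(2) unfolding lin_zero_def by blast
qed

subsection \<open>Triangular decompositions\<close>

lemma tau_dim_eq: "tau_dim R M = Sup {enat k | k. \<exists>N p. tri_decomp R M k N p}"
proof -
  have "(\<exists>N. is_direct_sum R M {1..k} N \<and> (\<forall>i\<in>{1..k}. N i \<noteq> {\<zero>\<^bsub>M\<^esub>}) \<and>
      (\<forall>i\<in>{1..k}. \<forall>j\<in>{1..k}. i < j \<longrightarrow> Hom_zero R (M \<restriction>\<^sub>M N i) (M \<restriction>\<^sub>M N j))) \<longleftrightarrow>
    (\<exists>N p. tri_decomp R M k N p)" (is "?l k \<longleftrightarrow> ?r k") for k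
  proof
    assume "?l k"
    then obtain N where N: "is_direct_sum R M {1..k} N" "\<forall>i\<in>{1..k}. N i \<noteq> {\<zero>\<^bsub>M\<^esub>}"
      "\<forall>i\<in>{1..k}. \<forall>j\<in>{1..k}. i < j \<longrightarrow> Hom_zero R (M \<restriction>\<^sub>M N i) (M \<restriction>\<^sub>M N j)" by blast
    obtain p where p: "proj_family R M {1..k} N p" using direct_sum_proj_family[OF N(1)] by auto
    have "tri_decomp R M k N p"
      using N p proj_familyD(1)[OF p] by (simp add: tri_decomp_def Hom_zero_iff)
    then show "?r k" by blast
  next
    assume "?r k"
    then obtain N p where N: "tri_decomp R M k N p" by blast
    then have p: "proj_family R M {1..k} N p" by (simp add: tri_decomp_def)
    have "is_direct_sum R M {1..k} N" by (rule proj_family_direct_sum[OF p]) simp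
    then show "?l k"
      using N proj_familyD(1)[OF p] by (intro exI[of _ N]) (simp add: tri_decomp_def Hom_zero_iff)
  qed
  then show ?thesis unfolding tau_dim_def by simp
qed

text \<open>\<open>A\<close> and \<open>B\<close> take the positions \<open>m\<close> and
  \<open>Suc m\<close>, and later terms move up by one. Vanishing of maps between parts of different
  old terms is inherited, since such a map extends to the old terms through a projection.\<close>

lemma tri_decomp_refine:
  assumes t: "tri_decomp R M k N p" and m: "m \<in> {1..k}"
    and A: "submodule A R M" "A \<noteq> {\<zero>\<^bsub>M\<^esub>}" "A \<subseteq> N m" and B: "submodule B R M" "B \<noteq> {\<zero>\<^bsub>M\<^esub>}" "B \<subseteq> N m"
    and a: "lin R M (N m) A a" "\<And>x. x \<in> A \<Longrightarrow> a x = x" "\<And>x. x \<in> B \<Longrightarrow> a x = \<zero>\<^bsub>M\<^esub>"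
    and b: "lin R M (N m) B b" "\<And>x. x \<in> B \<Longrightarrow> b x = x" "\<And>x. x \<in> A \<Longrightarrow> b x = \<zero>\<^bsub>M\<^esub>"
    and ab: "\<And>x. x \<in> N m \<Longrightarrow> a x = \<zero>\<^bsub>M\<^esub> \<Longrightarrow> b x = \<zero>\<^bsub>M\<^esub> \<Longrightarrow> x = \<zero>\<^bsub>M\<^esub>"
    and AB: "lin_zero R M A B"
  shows "\<exists>N p. tri_decomp R M (Suc k) N p"
proof -
  have pf: "proj_family R M {1..k} N p" and nz: "\<And>i. i \<in> {1..k} \<Longrightarrow> N i \<noteq> {\<zero>\<^bsub>M\<^esub>}"
    and tri: "\<And>i j. i \<in> {1..k} \<Longrightarrow> j \<in> {1..k} \<Longrightarrow> i < j \<Longrightarrow> lin_zero R M (N i) (N j)"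
    using t by (auto simp: tri_decomp_def)
  note pfD = proj_familyD[OF pf]
  \<comment> \<open>\<open>c i\<close> is the old index of the component that contains the new component \<open>i\<close>\<close>
  define c where "c i = (if i \<le> m then i else i - 1)" for i :: nat
  define N' where "N' i = (if i = m then A else if i = Suc m then B else N (c i))" for i
  \<comment> \<open>\<open>r i\<close> projects the old component \<open>N (c i)\<close> onto the
    new component \<open>N' i\<close>; it is the identity unless \<open>c i = m\<close>.\<close>
  define r where "r i = (if i = m then a else if i = Suc m then b else (\<lambda>x. x))" for i
  have ck: "c i \<in> {1..k}" if "i \<in> {1..Suc k}" for i using that m by (auto simp: c_def)
  have cm: "c m = m" "c (Suc m) = m" by (auto simp: c_def)
  have ceq: "i = m \<and> j = Suc m \<or> i = Suc m \<and> j = m" if "c i = c j" "i \<noteq> j" for i j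
    using that by (auto simp: c_def split: if_splits)
  have sub: "submodule (N' i) R M" "N' i \<subseteq> N (c i)" "N' i \<noteq> {\<zero>\<^bsub>M\<^esub>}" if "i \<in> {1..Suc k}" for i
    using A B pfD(1)[OF ck[OF that]] nz[OF ck[OF that]] by (auto simp: N'_def cm)
  have rl: "lin R M (N (c i)) (N' i) (r i)" for i
    using a b lin_id[of "N (c i)" "N (c i)"] by (auto simp: N'_def r_def cm)
  have rid: "r i x = x" if "x \<in> N' i" for i x
    using that a(2) b(2) by (auto simp: r_def N'_def split: if_splits)
  have pN: "p (c i) x \<in> N (c i)" if "i \<in> {1..Suc k}" "x \<in> carrier M" for i x
    using linD(1)[OF pfD(2)[OF ck]] that by auto
  have "proj_family R M {1..Suc k} N' (\<lambda>i x. r i (p (c i) x))"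
    unfolding proj_family_def
  proof (intro conjI ballI impI)
    fix i assume i: "i \<in> {1..Suc k}"
    show "submodule (N' i) R M" by (rule sub[OF i])
    show "lin R M (carrier M) (N' i) (\<lambda>x. r i (p (c i) x))"
      by (rule lin_comp[OF pfD(2)[OF ck[OF i]] rl])
  next
    fix i j x assume i: "i \<in> {1..Suc k}" and j: "j \<in> {1..Suc k}" and x: "x \<in> N' j"
    have xN: "x \<in> N (c j)" using sub(2)[OF j] x by auto
    consider "i = j" | "i \<noteq> j" "c i = c j" | "c i \<noteq> c j" by auto
    then show "r i (p (c i) x) = (if i = j then x else \<zero>\<^bsub>M\<^esub>)"
    proof cases
      case 1
      then show ?thesis using pfD(3)[OF ck[OF j] xN] rid[OF x] by simp
    next
      case 2
      then have "r i x = \<zero>\<^bsub>M\<^esub>"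
        using ceq[OF 2(2,1)] x a(3) b(3) by (auto simp: r_def N'_def)
      then show ?thesis using pfD(3)[OF ck[OF j] xN] 2 by simp
    next
      case 3
      then show ?thesis
        using pfD(4)[OF ck[OF i] ck[OF j] 3 xN] lin_0[OF rl pfD(1)[OF ck[OF i]] sub(1)[OF i]] by auto
    qed
  next
    fix x assume x: "x \<in> carrier M" and z: "\<forall>i\<in>{1..Suc k}. r i (p (c i) x) = \<zero>\<^bsub>M\<^esub>"
    have "p i x = \<zero>\<^bsub>M\<^esub>" if i: "i \<in> {1..k}" for i
    proof -
      consider "i < m" | "i = m" | "i > m" by linarith
      then show ?thesis
      proof cases
        case 1
        then show ?thesis using z[rule_format, of i] i by (simp add: r_def c_def)
      next
        case 2
        then have "a (p m x) = \<zero>\<^bsub>M\<^esub>" "b (p m x) = \<zero>\<^bsub>M\<^esub>"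
          using z[rule_format, of m] z[rule_format, of "Suc m"] m by (simp_all add: r_def c_def)
        then show ?thesis using ab linD(1)[OF pfD(2)[OF m] x] 2 by auto
      next
        case 3
        \<comment> \<open>An old term beyond \<open>m\<close> sits at the new position
          \<open>Suc i\<close>.\<close>
        then show ?thesis using z[rule_format, of "Suc i"] i by (simp add: r_def c_def)
      qed
    qed
    then show "x = \<zero>\<^bsub>M\<^esub>" by (rule pfD(5)[OF x])
  qed
  moreover have "lin_zero R M (N' i) (N' j)" if ij: "i \<in> {1..Suc k}" "j \<in> {1..Suc k}" "i < j" for i j
  proof (cases "c i = c j")
    case True
    then have "i = m" "j = Suc m" using ceq[of i j] ij(3) by auto
    then show ?thesis using AB by (simp add: N'_def)
  next
    case False
    then have "c i < c j" using ij(3) by (auto simp: c_def split: if_splits)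
    then have z: "lin_zero R M (N (c i)) (N (c j))" using tri ck ij by blast
    show ?thesis
      unfolding lin_zero_def
    proof (intro allI impI ballI)
      fix f x assume f: "lin R M (N' i) (N' j) f" and x: "x \<in> N' i"
      \<comment> \<open>Precomposing with \<open>r i\<close> extends \<open>f\<close> to the whole
        old term without changing it on \<open>N' i\<close>.\<close>
      have "lin R M (N (c i)) (N (c j)) (\<lambda>x. f (r i x))"
        by (rule lin_mono[OF lin_comp[OF rl f] order_refl sub(2)[OF ij(2)]])
      then have "f (r i x) = \<zero>\<^bsub>M\<^esub>" by (rule lin_zeroD[OF z]) (use sub(2)[OF ij(1)] x in auto)
      then show "f x = \<zero>\<^bsub>M\<^esub>" using rid[OF x] by simp
    qed
  qed
  ultimately have "tri_decomp R M (Suc k) N' (\<lambda>i x. r i (p (c i) x))"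
    using sub(3) by (simp add: tri_decomp_def)
  then show ?thesis by blast
qed

section \<open>Consequences of the Baer property and of retractability\<close>

lemma baer_annihilator:
  assumes "baer R M" and X: "X \<noteq> {}" "\<And>g. g \<in> X \<Longrightarrow> lin R M (carrier M) (carrier M) g"
  shows "direct_summand R M {x\<in>carrier M. \<forall>g\<in>X. g x = \<zero>\<^bsub>M\<^esub>}"
proof -
  \<comment> \<open>\<open>baer\<close> speaks of extensional endomorphisms; restricting to the
    carrier leaves the kernels unchanged.\<close>
  define Y where "Y = (\<lambda>g. restrict g (carrier M)) ` X"
  have "Y \<subseteq> Hom R M M" using lin_Hom[OF X(2) carrier_submodule] by (auto simp: Y_def)
  moreover have "Y \<noteq> {}" using X(1) by (simp add: Y_def)
  ultimately have "direct_summand R M (\<Inter>f\<in>Y. a_kernel M M f)" using assms(1) by (auto simp: baer_def)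
  moreover have "(\<Inter>f\<in>Y. a_kernel M M f) = {x\<in>carrier M. \<forall>g\<in>X. g x = \<zero>\<^bsub>M\<^esub>}"
    using X(1) by (auto simp: Y_def a_kernel_def')
  ultimately show ?thesis by simp
qed

text \<open>A nonzero \<open>x\<close> killed by all maps into \<open>Q\<close> makes their common
  kernel \<open>K\<close> nonzero, and the Baer property splits \<open>K\<close> off
  \<open>P\<close>. A nonzero complement \<open>L\<close> allows a refinement of the decomposition,
  while a zero one contradicts retractability.\<close>

lemma maximal_tri_decomp_prime:
  assumes baer: "baer R M" and t: "tri_decomp R M k N p" and m: "m \<in> {1..k}"
    and max: "\<nexists>N p. tri_decomp R M (Suc k) N p"
    and ret: "retractable R (M \<restriction>\<^sub>M N m)"
  shows "prime_module R (M \<restriction>\<^sub>M N m)"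
proof -
  have pf: "proj_family R M {1..k} N p" using t by (simp add: tri_decomp_def)
  define P where "P = N m"
  have P: "submodule P R M" and pl: "lin R M (carrier M) P (p m)" and pid: "\<And>x. x \<in> P \<Longrightarrow> p m x = x"
    using proj_familyD[OF pf] m by (auto simp: P_def)
  have Pc: "x \<in> carrier M" if "x \<in> P" for x using submoduleD(3)[OF P that] .
  have "\<exists>h. lin R M P Q h \<and> h x \<noteq> \<zero>\<^bsub>M\<^esub>"
    if Q: "submodule Q R M" "Q \<subseteq> P" "Q \<noteq> {\<zero>\<^bsub>M\<^esub>}" and x: "x \<in> P" "x \<noteq> \<zero>\<^bsub>M\<^esub>" for Q x
  proof (rule ccontr)
    assume no: "\<nexists>h. lin R M P Q h \<and> h x \<noteq> \<zero>\<^bsub>M\<^esub>"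
    define K where "K = {y\<in>P. \<forall>h. lin R M P Q h \<longrightarrow> h y = \<zero>\<^bsub>M\<^esub>}"
    have K: "submodule K R M"
      using submoduleD[OF P] by (auto simp: submodule_iff K_def lin_0[OF _ P Q(1)] linD(2,3)[of R M P Q] smult_zero)
    \<comment> \<open>The Baer property concerns endomorphisms of \<open>M\<close>, so the maps from
      \<open>P\<close> are precomposed with \<open>p m\<close>. Their common kernel is then the
      preimage of \<open>K\<close> under \<open>p m\<close>.\<close>
    have "{y\<in>carrier M. \<forall>g\<in>{(\<lambda>y. h (p m y)) | h. lin R M P Q h}. g y = \<zero>\<^bsub>M\<^esub>} = {y\<in>carrier M. p m y \<in> K}"
      using linD(1)[OF pl] by (auto simp: K_def)
    moreover have "direct_summand R M {y\<in>carrier M. \<forall>g\<in>{(\<lambda>y. h (p m y)) | h. lin R M P Q h}. g y = \<zero>\<^bsub>M\<^esub>}"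
    proof (rule baer_annihilator[OF baer])
      show "{(\<lambda>y. h (p m y)) | h. lin R M P Q h} \<noteq> {}" using lin_const_zero[OF Q(1)] by blast
      fix g assume "g \<in> {(\<lambda>y. h (p m y)) | h. lin R M P Q h}"
      then show "lin R M (carrier M) (carrier M) g"
        using lin_mono[OF lin_comp[OF pl] order_refl submoduleD(1)[OF Q(1)]] by auto
    qed
    ultimately have "direct_summand R M {y\<in>carrier M. p m y \<in> K}" by simp
    then obtain e where "submodule {y\<in>carrier M. p m y \<in> K} R M"
      and e: "lin R M (carrier M) {y\<in>carrier M. p m y \<in> K} e"
      and eid: "\<And>y. y \<in> {y\<in>carrier M. p m y \<in> K} \<Longrightarrow> e y = y"
      by (rule direct_summand_projection) blast
    \<comment> \<open>\<open>e\<close> projects \<open>M\<close> onto the preimage of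
      \<open>K\<close>; followed by \<open>p m\<close> it gives a projection \<open>a\<close> of
      \<open>P\<close> onto \<open>K\<close>. The complementary projection \<open>b\<close> has as
      its image the kernel \<open>L\<close> of \<open>a\<close>.\<close>
    define a where "a y = p m (e y)" for y
    define b where "b y = y \<ominus>\<^bsub>M\<^esub> a y" for y
    define L where "L = {y\<in>P. a y = \<zero>\<^bsub>M\<^esub>}"
    have KP: "K \<subseteq> P" and LP: "L \<subseteq> P" by (auto simp: K_def L_def)
    have al: "lin R M P K a"
      using linD[OF e] linD[OF pl] Pc by (auto simp: lin_def a_def)
    have aP: "lin R M P P a" by (rule lin_mono[OF al order_refl KP])
    have aid: "a y = y" if "y \<in> K" for y
      using that KP eid[of y] pid[of y] Pc by (auto simp: a_def)
    have L: "submodule L R M" unfolding L_def by (rule submodule_kernel[OF aP P P])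
    have "lin R M P P b" unfolding b_def by (rule lin_diff[OF lin_id aP P P]) simp
    moreover have bL: "b y \<in> L" if "y \<in> P" for y
    proof -
      have "a y \<in> P" "a y \<in> carrier M" "a (a y) = a y"
        using linD(1)[OF al that] KP Pc aid by auto
      then show ?thesis
        using that lin_minus[OF aP P P that] submoduleD(7)[OF P that] by (simp add: L_def b_def minus_eq_zero_iff)
    qed
    ultimately have bl: "lin R M P L b" by (simp add: lin_def)
    have bK: "b y = \<zero>\<^bsub>M\<^esub>" if "y \<in> K" for y using that aid KP Pc by (auto simp: b_def minus_eq_zero_iff)
    have bid: "b y = y" if "y \<in> L" for y
      using that Pc by (auto simp: b_def L_def M.minus_eq)
    have ab: "y = \<zero>\<^bsub>M\<^esub>" if "y \<in> P" "a y = \<zero>\<^bsub>M\<^esub>" "b y = \<zero>\<^bsub>M\<^esub>" for y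
      using that Pc[OF that(1)] by (simp add: b_def minus_eq_zero_iff)
    \<comment> \<open>For \<open>h\<close> from \<open>P\<close> to \<open>Q\<close>, the composite
      of \<open>a\<close>, \<open>u\<close> and \<open>h\<close> is again a map from
      \<open>P\<close> to \<open>Q\<close>, hence vanishes on \<open>K\<close>. So
      \<open>u y\<close> lies in \<open>K\<close> as well as in \<open>L\<close>; \<open>a\<close>
      both fixes it and kills it.\<close>
    have KL: "lin_zero R M K L"
      unfolding lin_zero_def
    proof (intro allI impI ballI)
      fix u y assume u: "lin R M K L u" and y: "y \<in> K"
      have "h (u y) = \<zero>\<^bsub>M\<^esub>" if h: "lin R M P Q h" for h
      proof -
        have "lin R M P Q (\<lambda>y. h (u (a y)))"
          by (rule lin_comp[OF lin_mono[OF lin_comp[OF al u] order_refl LP] h])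
        then have "h (u (a y)) = \<zero>\<^bsub>M\<^esub>" using y by (auto simp: K_def)
        then show ?thesis using aid[OF y] by simp
      qed
      then have "u y \<in> K" using linD(1)[OF u y] LP by (auto simp: K_def)
      then show "u y = \<zero>\<^bsub>M\<^esub>" using aid linD(1)[OF u y] by (auto simp: L_def)
    qed
    have "K \<noteq> {\<zero>\<^bsub>M\<^esub>}" using no x by (auto simp: K_def)
    \<comment> \<open>If \<open>L\<close> is zero, then \<open>K\<close> is all of \<open>P\<close>,
      so every map from \<open>P\<close> to the nonzero \<open>Q\<close> vanishes.\<close>
    moreover have "L \<noteq> {\<zero>\<^bsub>M\<^esub>}"
    proof
      assume L0: "L = {\<zero>\<^bsub>M\<^esub>}"
      have "y \<in> K" if y: "y \<in> P" for y
        using bL[OF y] linD(1)[OF al y] KP Pc y L0 by (auto simp: b_def minus_eq_zero_iff)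
      then have "lin_zero R M P Q" by (auto simp: lin_zero_def K_def)
      then show False using ret Q by (simp add: retractable_iff P flip: P_def)
    qed
    moreover have "a y = \<zero>\<^bsub>M\<^esub>" if "y \<in> L" for y using that by (simp add: L_def)
    ultimately have "\<exists>N p. tri_decomp R M (Suc k) N p"
      using tri_decomp_refine[OF t m, folded P_def, of K L a b] K L KP LP al bl aid bid bK ab KL by blast
    then show False using max by blast
  qed
  then show ?thesis by (auto simp: prime_module_iff P simp flip: P_def)
qed

text \<open>Since the kernel of \<open>f\<close> after \<open>p i\<close> is a direct summand,
  \<open>f\<close> splits over its image. Retractability gives a nonzero map from \<open>N j\<close>
  into that image, and the splitting carries it to a nonzero map from \<open>N j\<close> to
  \<open>N i\<close>.\<close>

lemma baer_lin_zero_sym: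
  assumes baer: "baer R M"
    and pf: "proj_family R M I N p" and ij: "i \<in> I" "j \<in> I" and ret: "retractable R (M \<restriction>\<^sub>M N j)"
    and z: "lin_zero R M (N j) (N i)"
  shows "lin_zero R M (N i) (N j)"
  unfolding lin_zero_def
proof (intro allI impI ballI, rule ccontr)
  fix f x assume f: "lin R M (N i) (N j) f" and x: "x \<in> N i" and fx: "f x \<noteq> \<zero>\<^bsub>M\<^esub>"
  note pfD = proj_familyD[OF pf]
  note Ni = pfD(1)[OF ij(1)] and Nj = pfD(1)[OF ij(2)] and pl = pfD(2)[OF ij(1)]
  have Nic: "y \<in> carrier M" if "y \<in> N i" for y using submoduleD(3)[OF Ni that] .
  have fp: "lin R M (carrier M) (N j) (\<lambda>y. f (p i y))" by (rule lin_comp[OF pl f])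
  define D where "D = {y\<in>carrier M. f (p i y) = \<zero>\<^bsub>M\<^esub>}"
  have "direct_summand R M {y\<in>carrier M. \<forall>g\<in>{\<lambda>y. f (p i y)}. g y = \<zero>\<^bsub>M\<^esub>}"
    using lin_mono[OF fp order_refl submoduleD(1)[OF Nj]] by (intro baer_annihilator[OF baer]) auto
  then have "direct_summand R M D" by (simp add: D_def)
  then obtain e where D: "submodule D R M" and e: "lin R M (carrier M) D e" and eid: "\<And>y. y \<in> D \<Longrightarrow> e y = y"
    by (rule direct_summand_projection) blast
  have Dc: "y \<in> carrier M" if "y \<in> D" for y using that by (simp add: D_def)
  \<comment> \<open>\<open>s\<close> subtracts \<open>e y\<close>, which \<open>f\<close> after
    \<open>p i\<close> kills, so \<open>f\<close> is unchanged in \<open>fs\<close>. As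
    \<open>e\<close> fixes \<open>D\<close>, \<open>s\<close> kills the kernel of \<open>f\<close>
    in \<open>N i\<close>, so it depends only on \<open>f y\<close>, as stated in
    \<open>seq\<close>.\<close>
  define s where "s y = p i (y \<ominus>\<^bsub>M\<^esub> e y)" for y
  have "lin R M (carrier M) (carrier M) (\<lambda>y. y \<ominus>\<^bsub>M\<^esub> e y)"
    by (rule lin_diff[OF lin_id lin_mono[OF e order_refl] carrier_submodule carrier_submodule]) (auto intro: Dc)
  then have sl: "lin R M (carrier M) (N i) s" unfolding s_def by (rule lin_comp[OF _ pl])
  have fs: "f (s y) = f y" if y: "y \<in> N i" for y
  proof -
    have ey: "e y \<in> D" using linD(1)[OF e Nic[OF y]] .
    have "f (p i (y \<ominus>\<^bsub>M\<^esub> e y)) = f (p i y) \<ominus>\<^bsub>M\<^esub> f (p i (e y))"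
      using lin_minus[OF fp carrier_submodule Nj] Nic[OF y] Dc[OF ey] by auto
    moreover have "f (p i (e y)) = \<zero>\<^bsub>M\<^esub>" using ey by (simp add: D_def)
    moreover have "f (p i y) = f y" using pfD(3)[OF ij(1) y] by simp
    moreover have "f y \<in> carrier M" using linD(1)[OF f y] submoduleD(3)[OF Nj] by auto
    ultimately show ?thesis by (simp add: s_def M.minus_eq)
  qed
  have seq: "s y = s w" if yw: "y \<in> N i" "w \<in> N i" "f y = f w" for y w
  proof -
    have v: "y \<ominus>\<^bsub>M\<^esub> w \<in> N i" using submoduleD(7)[OF Ni] yw by auto
    have "f w \<in> carrier M" using linD(1)[OF f yw(2)] submoduleD(3)[OF Nj] by auto
    then have "f (y \<ominus>\<^bsub>M\<^esub> w) = \<zero>\<^bsub>M\<^esub>" using lin_minus[OF f Ni Nj yw(1,2)] yw(3) by (simp add: minus_eq_zero_iff)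
    then have "y \<ominus>\<^bsub>M\<^esub> w \<in> D" using pfD(3)[OF ij(1) v] Nic[OF v] by (simp add: D_def)
    then have "s (y \<ominus>\<^bsub>M\<^esub> w) = \<zero>\<^bsub>M\<^esub>"
      using eid Nic[OF v] lin_0[OF pl carrier_submodule Ni] by (simp add: s_def M.minus_eq M.r_neg)
    moreover have "s y \<in> carrier M" "s w \<in> carrier M" using linD(1)[OF sl] Nic yw by auto
    ultimately show ?thesis
      using lin_minus[OF sl carrier_submodule Ni] Nic yw by (simp add: minus_eq_zero_iff)
  qed
  \<comment> \<open>\<open>t\<close> is a section of \<open>f\<close> over its image, well-defined by \<open>seq\<close>\<close>
  define t where "t w = s (SOME y. y \<in> N i \<and> f y = w)" for w
  have tf: "t (f y) = s y" if y: "y \<in> N i" for y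
    unfolding t_def by (rule someI2[of _ y], simp add: y) (blast intro: seq y)
  have tl: "lin R M (f ` N i) (N i) t"
    unfolding lin_def
  proof (intro conjI ballI funcsetI)
    fix v assume "v \<in> f ` N i"
    then obtain y where y: "y \<in> N i" "v = f y" by auto
    show "t v \<in> N i" using linD(1)[OF sl Nic[OF y(1)]] tf[OF y(1)] y(2) by simp
    fix w assume "w \<in> f ` N i"
    then obtain z where z: "z \<in> N i" "w = f z" by auto
    show "t (v \<oplus>\<^bsub>M\<^esub> w) = t v \<oplus>\<^bsub>M\<^esub> t w"
      using tf[OF submoduleD(4)[OF Ni y(1) z(1)]] tf[OF y(1)] tf[OF z(1)] y(2) z(2)
        linD(2)[OF f y(1) z(1)] linD(2)[OF sl Nic[OF y(1)] Nic[OF z(1)]] by simp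
  next
    fix c v assume c: "c \<in> carrier R" and "v \<in> f ` N i"
    then obtain y where y: "y \<in> N i" "v = f y" by auto
    show "t (c \<odot>\<^bsub>M\<^esub> v) = c \<odot>\<^bsub>M\<^esub> t v"
      using tf[OF submoduleD(5)[OF Ni c y(1)]] tf[OF y(1)] y(2)
        linD(3)[OF f c y(1)] linD(3)[OF sl c Nic[OF y(1)]] by simp
  qed
  have "f ` N i \<subseteq> N j" "f ` N i \<noteq> {\<zero>\<^bsub>M\<^esub>}" using linD(1)[OF f] x fx by auto
  then have "\<not> lin_zero R M (N j) (f ` N i)"
    using ret submodule_image[OF f Ni Nj] unfolding retractable_iff[OF Nj] by blast
  then obtain g y where g: "lin R M (N j) (f ` N i) g" and y: "y \<in> N j" "g y \<noteq> \<zero>\<^bsub>M\<^esub>"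
    by (auto simp: lin_zero_def)
  \<comment> \<open>\<open>t\<close> after \<open>g\<close> maps \<open>N j\<close> to
    \<open>N i\<close> and so vanishes, yet applying \<open>f\<close> to \<open>t (g y)\<close>
    recovers the nonzero \<open>g y\<close>.\<close>
  have "t (g y) = \<zero>\<^bsub>M\<^esub>" using lin_zeroD[OF z lin_comp[OF g tl] y(1)] .
  moreover obtain w where w: "w \<in> N i" "g y = f w" using linD(1)[OF g y(1)] by auto
  ultimately have "f w = f \<zero>\<^bsub>M\<^esub>" using tf[OF w(1)] fs[OF w(1)] by simp
  then show False using y(2) w(2) lin_0[OF f Ni Nj] by simp
qed

text \<open>Given an isomorphism of \<open>C\<close> inside \<open>A\<close> with \<open>D\<close>
  inside \<open>B\<close>, retractability yields a nonzero map from \<open>A\<close> to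
  \<open>C\<close>, and its composite with the isomorphism is a nonzero map from \<open>A\<close> to
  \<open>B\<close>.\<close>

lemma retractable_lin_zero_orthogonal:
  assumes A: "submodule A R M" and B: "submodule B R M" and ret: "retractable R (M \<restriction>\<^sub>M A)"
    and z: "lin_zero R M A B"
  shows "orthogonal_modules R (M \<restriction>\<^sub>M A) (M \<restriction>\<^sub>M B)"
  unfolding orthogonal_iff[OF A B]
proof (intro allI impI notI, elim conjE)
  fix C D f assume C: "submodule C R M" "C \<subseteq> A" "C \<noteq> {\<zero>\<^bsub>M\<^esub>}"
    and D: "submodule D R M" "D \<subseteq> B" and f: "lin R M C D f" and bij: "bij_betw f C D"
  obtain g x where g: "lin R M A C g" and x: "x \<in> A" "g x \<noteq> \<zero>\<^bsub>M\<^esub>"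
    using ret C unfolding retractable_iff[OF A] lin_zero_def by blast
  have "f (g x) = \<zero>\<^bsub>M\<^esub>" using lin_zeroD[OF z lin_mono[OF lin_comp[OF g f] order_refl D(2)] x(1)] .
  then have "f (g x) = f \<zero>\<^bsub>M\<^esub>" using lin_0[OF f C(1) D(1)] by simp
  then show False
    using bij x linD(1)[OF g x(1)] submoduleD(2)[OF C(1)] by (auto simp: bij_betw_def inj_on_def)
qed

lemma maximal_tri_decomp:
  assumes "tau_dim R M < \<infinity>" and "carrier M \<noteq> {\<zero>\<^bsub>M\<^esub>}"
  obtains k N p where "tri_decomp R M k N p" "\<nexists>N p. tri_decomp R M (Suc k) N p"
proof -
  obtain b where b: "tau_dim R M = enat b" using assms(1) by (cases "tau_dim R M") auto
  have le: "k \<le> b" if "\<exists>N p. tri_decomp R M k N p" for k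
  proof -
    have "enat k \<le> tau_dim R M" unfolding tau_dim_eq using that by (intro Sup_upper) auto
    then show ?thesis using b by simp
  qed
  \<comment> \<open>\<open>M\<close> itself is a decomposition of length one, so the set of lengths
    is nonempty and, being bounded by \<open>b\<close>, has a greatest element.\<close>
  have "proj_family R M {1..1::nat} (\<lambda>_. carrier M) (\<lambda>_ x. x)"
    by (simp add: proj_family_def carrier_submodule lin_id)
  then have "tri_decomp R M 1 (\<lambda>_. carrier M) (\<lambda>_ x. x)"
    using assms(2) by (simp add: tri_decomp_def)
  then have ex: "\<exists>N p. tri_decomp R M 1 N p" by blast
  define k where "k = (GREATEST k. \<exists>N p. tri_decomp R M k N p)"
  have "\<exists>N p. tri_decomp R M k N p" unfolding k_def
    by (rule GreatestI_nat[where P = "\<lambda>k. \<exists>N p. tri_decomp R M k N p", OF ex]) (rule le)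
  moreover have "\<nexists>N p. tri_decomp R M (Suc k) N p"
    using Greatest_le_nat[of "\<lambda>k. \<exists>N p. tri_decomp R M k N p" "Suc k" b] le unfolding k_def by fastforce
  ultimately show ?thesis using that by blast
qed

end

theorem theorem3p6:
  fixes R :: "('a, 'r) ring_scheme" and M :: "('a, 'b, 'm) module_scheme"
  assumes "right_module R M"
    and "carrier M \<noteq> {\<zero>\<^bsub>M\<^esub>}"
    and "baer R M"
  shows "(\<exists>(n::nat) N.
            is_direct_sum R M {1..n} N \<and>
            (\<forall>i\<in>{1..n}. prime_module R (M \<restriction>\<^sub>M N i)) \<and>
            (\<forall>i\<in>{1..n}. \<forall>j\<in>{1..n}. i \<noteq> j \<longrightarrow>
               orthogonal_modules R (M \<restriction>\<^sub>M N i) (M \<restriction>\<^sub>M N j)) \<and>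
            (\<forall>i\<in>{1..n}. \<forall>j\<in>{1..n}. i \<noteq> j \<longrightarrow> Hom_zero R (M \<restriction>\<^sub>M N i) (M \<restriction>\<^sub>M N j)))
         \<longleftrightarrow>
         (tau_dim R M < \<infinity> \<and> (\<forall>D. direct_summand R M D \<longrightarrow> retractable R (M \<restriction>\<^sub>M D)))"
    (is "?lhs \<longleftrightarrow> ?rhs")
proof -
  interpret right_module R M by fact
  show ?thesis
  proof
    assume ?lhs
    then obtain n and N :: "nat \<Rightarrow> 'b set" where ds: "is_direct_sum R M {1..n} N"
      and pr: "\<And>i. i \<in> {1..n} \<Longrightarrow> prime_module R (M \<restriction>\<^sub>M N i)"
      and orth: "\<And>i j. i \<in> {1..n} \<Longrightarrow> j \<in> {1..n} \<Longrightarrow> i \<noteq> j \<Longrightarrow> orthogonal_modules R (M \<restriction>\<^sub>M N i) (M \<restriction>\<^sub>M N j)"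
      and hz: "\<And>i j. i \<in> {1..n} \<Longrightarrow> j \<in> {1..n} \<Longrightarrow> i \<noteq> j \<Longrightarrow> Hom_zero R (M \<restriction>\<^sub>M N i) (M \<restriction>\<^sub>M N j)"
      by blast
    obtain p where pf: "proj_family R M {1..n} N p" using direct_sum_proj_family[OF ds] by auto
    have lz: "lin_zero R M (N i) (N j)" if "i \<in> {1..n}" "j \<in> {1..n}" "i \<noteq> j" for i j
      using hz[OF that] Hom_zero_iff proj_familyD(1)[OF pf] that by blast
    have "k \<le> n" if "tri_decomp R M k L q" for k L q
      using prime_decomposition_bound[OF pf _ pr lz, of "{1..k}" L q] that by (simp add: tri_decomp_def)
    then have "tau_dim R M \<le> enat n" unfolding tau_dim_eq by (intro Sup_least) auto
    then have "tau_dim R M < \<infinity>" by (cases "tau_dim R M") auto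
    moreover have "retractable R (M \<restriction>\<^sub>M D)" if "direct_summand R M D" for D
      using prime_decomposition_retractable[OF pf _ pr orth] that by (simp add: direct_summand_def)
    ultimately show ?rhs by blast
  next
    assume rhs: ?rhs
    obtain k N p where t: "tri_decomp R M k N p" and max: "\<nexists>N p. tri_decomp R M (Suc k) N p"
      using maximal_tri_decomp rhs assms(2) by blast
    have pf: "proj_family R M {1..k} N p"
      and tri: "\<And>i j. i \<in> {1..k} \<Longrightarrow> j \<in> {1..k} \<Longrightarrow> i < j \<Longrightarrow> lin_zero R M (N i) (N j)"
      using t by (auto simp: tri_decomp_def)
    note pfD = proj_familyD[OF pf]
    \<comment> \<open>The projection \<open>p i\<close> exhibits \<open>N i\<close> as a direct
      summand, so the hypothesis on summands applies.\<close>
    have ret: "retractable R (M \<restriction>\<^sub>M N i)" if "i \<in> {1..k}" for i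
      using projection_direct_summand[OF pfD(1,2)[OF that] pfD(3)[OF that]] that rhs by blast
    \<comment> \<open>For \<open>i < j\<close> this is triangularity; for \<open>i > j\<close>
      triangularity gives the opposite direction, which \<open>baer_lin_zero_sym\<close>
      reverses.\<close>
    have lz: "lin_zero R M (N i) (N j)" if "i \<in> {1..k}" "j \<in> {1..k}" "i \<noteq> j" for i j
      using tri[OF that(1,2)] tri[OF that(2,1)] baer_lin_zero_sym[OF assms(3) pf that(1,2) ret[OF that(2)]] that(3)
      by linarith
    have "is_direct_sum R M {1..k} N" by (rule proj_family_direct_sum[OF pf]) simp
    moreover have "prime_module R (M \<restriction>\<^sub>M N i)" if "i \<in> {1..k}" for i
      by (rule maximal_tri_decomp_prime[OF assms(3) t that max ret[OF that]])
    moreover have "orthogonal_modules R (M \<restriction>\<^sub>M N i) (M \<restriction>\<^sub>M N j)" "Hom_zero R (M \<restriction>\<^sub>M N i) (M \<restriction>\<^sub>M N j)"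
      if "i \<in> {1..k}" "j \<in> {1..k}" "i \<noteq> j" for i j
      using retractable_lin_zero_orthogonal[OF pfD(1)[OF that(1)] pfD(1)[OF that(2)] ret[OF that(1)] lz[OF that]]
        Hom_zero_iff[OF pfD(1)[OF that(1)] pfD(1)[OF that(2)]] lz[OF that] by auto
    ultimately show ?lhs by blast
  qed
qed

end
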